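(* For every topological graph $X$ we have $h(Homeo(X),X)<+\infty$ and $P_h(X)=\{h(Homeo(X),X),\,h(Homeo(X),X)+1,\,h(Homeo(X),X)+2,\ldots\}\cup\{+\infty\}$.
   Context: A topological graph is a compact connected metric space which is a finite union of arcs (spaces homeomorphic to $[0,1]$; the points corresponding to $0,1$ are the end points) such that any two of these arcs intersect in at most their end points. For a topological space $A$, $Homeo(A)$ denotes the group of all homeomorphisms $A\to A$ under composition. For a subgroup $G$ of $Homeo(A)$ (acting by $gx=g(x)$), a nonempty subset $Y\subseteq A$ is invariant if $g(y)\in Y$ for all $g\in G$, $y\in Y$. The height of $(G,A)$ is $h(G,A)=\sup\{n\geq 0:$ there exist distinct closed invariant subsets $Y_0\subset Y_1\subset\cdots\subset Y_n=A\}$ (possibly $+\infty$). Finally $P_h(A)=\{h(G,A): G \text{ is a subgroup of } Homeo(A)\}$. *)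

theory Defs
  imports "HOL-Analysis.Analysis" "HOL-Library.Extended_Nat"
begin

definition topological_graph :: "'a::metric_space set \<Rightarrow> bool" where
  "topological_graph X \<longleftrightarrow> compact X \<and> connected X \<and>
     (\<exists>F :: (real \<Rightarrow> 'a) set. finite F \<and> F \<noteq> {} \<and> (\<forall>g\<in>F. arc g) \<and>
        X = (\<Union>g\<in>F. path_image g) \<and>
        (\<forall>g\<in>F. \<forall>h\<in>F. g \<noteq> h \<longrightarrow>
            path_image g \<inter> path_image h \<subseteq>
              {pathstart g, pathfinish g} \<inter> {pathstart h, pathfinish h}))"

text \<open>Homeo(X): homeomorphisms of X onto itself, normalised to be the identity
outside X so that composition is the group operation.\<close>

definition Homeo :: "'a::topological_space set \<Rightarrow> ('a \<Rightarrow> 'a) set" where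
  "Homeo X = {f. (\<exists>g. homeomorphism X X f g) \<and> (\<forall>x. x \<notin> X \<longrightarrow> f x = x)}"

definition homeo_subgroup :: "'a::topological_space set \<Rightarrow> ('a \<Rightarrow> 'a) set \<Rightarrow> bool" where
  "homeo_subgroup X G \<longleftrightarrow> G \<subseteq> Homeo X \<and> id \<in> G \<and>
     (\<forall>f\<in>G. \<forall>g\<in>G. f \<circ> g \<in> G) \<and>
     (\<forall>f\<in>G. \<exists>g\<in>G. homeomorphism X X f g)"

definition invariant_set :: "('a \<Rightarrow> 'a) set \<Rightarrow> 'a set \<Rightarrow> 'a set \<Rightarrow> bool" where
  "invariant_set G X Y \<longleftrightarrow> Y \<noteq> {} \<and> Y \<subseteq> X \<and> (\<forall>g\<in>G. \<forall>y\<in>Y. g y \<in> Y)"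

definition closed_invariant :: "('a \<Rightarrow> 'a) set \<Rightarrow> 'a::topological_space set \<Rightarrow> 'a set \<Rightarrow> bool" where
  "closed_invariant G X Y \<longleftrightarrow> invariant_set G X Y \<and> closedin (top_of_set X) Y"

definition height :: "('a \<Rightarrow> 'a) set \<Rightarrow> 'a::topological_space set \<Rightarrow> enat" where
  "height G X = Sup {enat n | n. \<exists>Y :: nat \<Rightarrow> 'a set.
      (\<forall>i\<le>n. closed_invariant G X (Y i)) \<and> (\<forall>i<n. Y i \<subset> Y (Suc i)) \<and> Y n = X}"

definition P_h :: "'a::topological_space set \<Rightarrow> enat set" where
  "P_h X = {height G X | G. homeo_subgroup X G}"

end

theory Submission
  imports Defs
begin

text \<open>If a group has finitely many orbits, each locally closed, then orbit closures order the orbits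
  partially and the height is the number of orbits minus one. Choose a presentation of the graph by
  open cells (loops allowed) with as few vertices as possible. A vertex that some homeomorphism moves
  into a cell is a common end of exactly two germs of cells; merging them removes the vertex, so by
  minimality it does not happen, unless the graph is a circle, which is handled through the stabilizer
  of a point. Hence the homeomorphism group preserves the vertices and permutes the cells, its
  infinite orbits are unions of cells, and there are finitely many orbits.

  To raise the height by exactly \<open>k\<close>, split a single infinite orbit into \<open>k + 1\<close> orbits. On the real
  line, let \<open>lev k t\<close> be \<open>0\<close> at integers, and between consecutive integers be one plus a copy of
  \<open>lev (k - 1)\<close> squeezed into the gap. Order automorphisms preserving \<open>lev k\<close> are transitive on each of
  its \<open>k + 1\<close> level sets, which are invariant under \<open>t \<mapsto> - t\<close> as well. Transporting \<open>lev k\<close> to all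
  cells of the orbit and passing to the subgroup preserving it leaves the other orbits unchanged.\<close>

section \<open>Level sets on the real line\<close>

text \<open>Heights can only grow when the group shrinks, so the full group gives the least value in
  \<open>P_h X\<close>; what has to be shown is that this value is finite and that every increment
  occurs. Local closedness matters because two different orbits, each dense in the other, could not
  be separated by closed invariant sets. The obstacle is that the given arcs are arbitrary: a vertex
  of degree two may be slid into a cell, so vertices need not be preserved. Erasing such a vertex
  can close up a curve, which is why cells are injective on the open interval only. On the circle
  every presentation has a vertex although the full group is transitive; there height
  \<open>0\<close> comes from the full group and all positive finite heights from subgroups of the
  stabilizer of the vertex. Levels have to be even functions because a homeomorphism may reverse a
  cell. Every cell is parametrised by the real line through the logistic function, so that the order
  automorphisms of the line act on all cells alike.\<close>

definition logistic :: "real \<Rightarrow> real" where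
  "logistic x = 1 / (1 + exp (- x))"

definition logit :: "real \<Rightarrow> real" where
  "logit t = ln (t / (1 - t))"

lemma logistic_bounds: "0 < logistic x" "logistic x < 1"
  by (auto simp: logistic_def add_pos_pos)

lemma logit_logistic [simp]: "logit (logistic x) = x"
proof -
  have "1 + exp (-x) > 0" by (simp add: add_pos_pos)
  then have "logistic x / (1 - logistic x) = exp x"
    by (simp add: logistic_def field_simps exp_minus)
  then show ?thesis by (simp add: logit_def)
qed

lemma logistic_logit: "logistic (logit t) = t" if "0 < t" "t < 1"
proof -
  have "exp (- logit t) = (1 - t) / t"
    using that by (simp add: logit_def exp_minus)
  moreover have "1 + (1 - t) / t = 1 / t" using that by (simp add: field_simps)
  ultimately show ?thesis by (simp add: logistic_def)
qed

lemma strict_mono_logistic: "strict_mono logistic"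
  by (rule strict_monoI) (simp add: logistic_def frac_less2 add_pos_pos)

lemma logistic_less_iff [simp]: "logistic x < logistic y \<longleftrightarrow> x < y"
  by (rule strict_mono_less[OF strict_mono_logistic])

lemma logistic_eq_iff [simp]: "logistic x = logistic y \<longleftrightarrow> x = y"
  by (rule strict_mono_eq[OF strict_mono_logistic])

lemma range_logistic: "range logistic = {0<..<1}"
proof -
  have "t \<in> range logistic" if "t \<in> {0<..<1}" for t
    using logistic_logit[of t] that by (metis greaterThanLessThan_iff rangeI)
  then show ?thesis using logistic_bounds by auto
qed

lemma logit_less_iff: "logit s < logit t \<longleftrightarrow> s < t" if "0 < s" "s < 1" "0 < t" "t < 1"
  using logistic_less_iff[of "logit s" "logit t"] that by (simp add: logistic_logit)

lemma logit_one_minus: "logit (1 - t) = - logit t" if "0 < t" "t < 1"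
  using that by (simp add: logit_def ln_div)

lemma continuous_on_logit: "continuous_on {0<..<1} logit"
  unfolding logit_def by (intro continuous_intros) auto

lemma continuous_on_logistic: "continuous_on S logistic"
proof -
  have "1 + exp (- x) \<noteq> 0" for x :: real
    by (metis add_pos_pos exp_gt_zero less_irrefl zero_less_one)
  then show ?thesis
    unfolding logistic_def by (intro continuous_intros) auto
qed

section \<open>Order automorphisms of the real line and nested level sets\<close>

definition order_aut :: "(real \<Rightarrow> real) \<Rightarrow> bool" where
  "order_aut g \<longleftrightarrow> strict_mono g \<and> surj g"

lemma order_aut_id [simp]: "order_aut (\<lambda>x. x)"
  by (auto simp: order_aut_def strict_mono_def)

lemma order_aut_translation: "order_aut (\<lambda>x. x + c)"
  unfolding order_aut_def strict_mono_def by (auto simp: surj_def intro: exI[of _ "_ - c"])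

lemma order_aut_comp: "order_aut (\<lambda>x. f (g x))" if "order_aut f" "order_aut g"
  using that unfolding order_aut_def strict_mono_def
  by (auto simp: surj_def) metis

lemma order_aut_bij: "order_aut g \<Longrightarrow> bij g"
  by (auto simp: order_aut_def bij_def strict_mono_imp_inj_on)

lemma order_aut_less_iff: "order_aut g \<Longrightarrow> g x < g y \<longleftrightarrow> x < y"
  by (simp add: order_aut_def strict_mono_less)

lemma order_aut_inv: "order_aut (inv g)" if g: "order_aut g"
proof -
  have b: "bij g" by (rule order_aut_bij[OF g])
  have "inv g x < inv g y" if "x < y" for x y
    using order_aut_less_iff[OF g, of "inv g x" "inv g y"] that b
    by (simp add: bij_is_surj surj_f_inv_f)
  then show ?thesis
    using b by (auto simp: order_aut_def strict_mono_def bij_imp_bij_inv bij_is_surj)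
qed

lemma order_aut_uminus:
  assumes "strict_antimono_on UNIV g" "surj g"
  shows "order_aut (\<lambda>x. - g x)"
proof -
  have "\<exists>x. y = - g x" for y
  proof -
    obtain x where "- y = g x" using assms(2) unfolding surj_def by blast
    then show ?thesis by (intro exI[of _ x]) simp
  qed
  then show ?thesis
    using assms(1) unfolding order_aut_def strict_mono_def monotone_on_def surj_def by simp
qed

text \<open>Iterating \<open>t \<mapsto> logit (frac t)\<close>, this counts the steps until an
  integer is met, stopping at \<open>k\<close>. For \<open>j < k\<close> the points of level at most
  \<open>j\<close> form a countable closed set of Cantor-Bendixson rank \<open>j + 1\<close>: the
  integers, then sequences in each gap accumulating at its two ends, and so on.\<close>

primrec lev :: "nat \<Rightarrow> real \<Rightarrow> nat" where
  "lev 0 t = 0"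
| "lev (Suc k) t = (if t \<in> \<int> then 0 else Suc (lev k (logit (frac t))))"

lemma frac_bounds: "0 < frac t" "frac t < 1" if "t \<notin> \<int>" for t :: real
  using that by (simp_all add: frac_gt_0_iff frac_lt_1)

lemma lev_le: "lev k t \<le> k"
  by (induction k arbitrary: t) auto

lemma lev_add_of_int [simp]: "lev k (t + of_int n) = lev k t"
proof (cases k)
  case (Suc m)
  have fr: "frac (t + of_int n) = frac t" by (simp add: frac_def)
  have "t + of_int n \<in> \<int> \<longleftrightarrow> t \<in> \<int>" unfolding frac_eq_0_iff[symmetric] fr ..
  then show ?thesis using Suc by (simp add: fr)
qed simp

text \<open>Negation replaces the fractional part of a non-integer by its complement to
  \<open>1\<close>, and \<open>logit\<close> turns this into negation again. This is what makes
  levels insensitive to the orientation of a cell.\<close>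

lemma lev_uminus [simp]: "lev k (- t) = lev k t"
proof (induction k arbitrary: t)
  case (Suc k)
  show ?case
  proof (cases "t \<in> \<int>")
    case False
    then have "logit (frac (- t)) = - logit (frac t)"
      by (simp add: frac_neg frac_bounds logit_one_minus)
    then show ?thesis using False by (simp add: minus_in_Ints_iff Suc)
  qed (simp add: minus_in_Ints_iff)
qed simp

lemma frac_in_unit:
  fixes n s :: real
  assumes "n \<in> \<int>" "0 < s" "s < 1"
  shows "n + s \<notin> \<int>" "frac (n + s) = s" "\<lfloor>n + s\<rfloor> = \<lfloor>n\<rfloor>"
proof -
  obtain m where m: "n = of_int m" using assms(1) by (rule Ints_cases)
  have fl: "\<lfloor>n + s\<rfloor> = m" using assms m by (intro floor_unique) auto
  then show fr: "frac (n + s) = s" "\<lfloor>n + s\<rfloor> = \<lfloor>n\<rfloor>" using m by (simp_all add: frac_def)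
  show "n + s \<notin> \<int>" unfolding frac_eq_0_iff[symmetric] fr using assms by simp
qed

text \<open>Needed for the exact count of orbits. A point of level one less, one stage down, is
  carried into the gap above \<open>0\<close> by \<open>logistic\<close>.\<close>

lemma lev_surj: "j \<le> k \<Longrightarrow> \<exists>t. lev k t = j"
proof (induction k arbitrary: j)
  case (Suc k)
  show ?case
  proof (cases j)
    case 0
    then show ?thesis by (intro exI[of _ 0]) simp
  next
    case (Suc i)
    then obtain t where "lev k t = i" using Suc.IH Suc.prems by auto
    then have "lev (Suc k) (logistic t) = j"
      using Suc frac_in_unit[OF Ints_0 logistic_bounds[of t]] by simp
    then show ?thesis by blast
  qed
qed simp

text \<open>One gap carries a copy of the open set one stage lower, and its integer translates serve
  all gaps. Openness of these upper sets is the source of local closedness of the level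
  sets.\<close>

lemma open_lev_greater: "open {t. j < lev k t}"
proof (induction k arbitrary: j)
  case (Suc k)
  show ?case
  proof (cases j)
    case 0
    then have "{t. j < lev (Suc k) t} = - \<int>" by auto
    then show ?thesis by (simp add: open_Compl closed_Ints)
  next
    case (Suc i)
    let ?U = "{0<..<1} \<inter> logit -` {t. i < lev k t}"
    have "open ?U"
      by (rule continuous_open_preimage[OF continuous_on_logit open_greaterThanLessThan Suc.IH])
    then have "open ((+) n ` ?U)" for n :: real by (rule open_translation)
    moreover have "{t. j < lev (Suc k) t} = (\<Union>n\<in>\<int>. (+) n ` ?U)"
    proof (intro set_eqI iffI)
      fix t assume "t \<in> {t. j < lev (Suc k) t}"
      then have t: "t \<notin> \<int>" "i < lev k (logit (frac t))"
        using Suc by (auto split: if_splits)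
      then have "frac t \<in> ?U" using frac_bounds[OF t(1)] by simp
      moreover have "t = of_int \<lfloor>t\<rfloor> + frac t" unfolding frac_def by linarith
      ultimately have "t \<in> (+) (of_int \<lfloor>t\<rfloor>) ` ?U" by (rule rev_image_eqI)
      then show "t \<in> (\<Union>n\<in>\<int>. (+) n ` ?U)" by (rule UN_I[OF Ints_of_int])
    next
      fix t assume "t \<in> (\<Union>n\<in>\<int>. (+) n ` ?U)"
      then obtain n u where u: "n \<in> \<int>" "u \<in> ?U" "t = n + u" by (elim UN_E imageE) (rule that)
      then have "t \<notin> \<int>" "frac t = u" using frac_in_unit[of n u] by auto
      then show "t \<in> {t. j < lev (Suc k) t}"
        using u(2) \<open>j = Suc i\<close> by simp
    qed
    ultimately show ?thesis by (metis (no_types, lifting) open_UN)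
  qed
qed simp

text \<open>Conjugating \<open>g\<close> into every gap between consecutive integers, with the
  integers fixed, lifts a symmetry of \<open>lev k\<close> to one of
  \<open>lev (Suc k)\<close>.\<close>

definition floorwise :: "(real \<Rightarrow> real) \<Rightarrow> real \<Rightarrow> real" where
  "floorwise g z = of_int \<lfloor>z\<rfloor> + (if z \<in> \<int> then 0 else logistic (g (logit (frac z))))"

lemma order_aut_floorwise:
  fixes g
  defines "f \<equiv> floorwise g"
  assumes g: "order_aut g"
  shows "order_aut f" "\<And>z. z \<notin> \<int> \<Longrightarrow> f z \<notin> \<int>" "\<And>z. z \<notin> \<int> \<Longrightarrow> logit (frac (f z)) = g (logit (frac z))"
    "\<And>z. z \<in> \<int> \<Longrightarrow> f z = z"
proof -
  have f: "f z = of_int \<lfloor>z\<rfloor> + logistic (g (logit (frac z)))" if "z \<notin> \<int>" for z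
    using that by (simp add: f_def floorwise_def)
  note unit = frac_in_unit[OF Ints_of_int logistic_bounds]
  show "f z \<notin> \<int>" if "z \<notin> \<int>" for z
    unfolding f[OF that] by (rule unit)
  show "logit (frac (f z)) = g (logit (frac z))" if "z \<notin> \<int>" for z
    unfolding f[OF that] unit by simp
  show fi: "f z = z" if "z \<in> \<int>" for z
    using that by (simp add: f_def floorwise_def)
  have fl: "\<lfloor>f z\<rfloor> = \<lfloor>z\<rfloor>" for z
    by (cases "z \<in> \<int>") (simp_all only: fi f unit floor_of_int not_False_eq_True)
  have "f z < f w" if "z < w" for z w
  proof (cases "\<lfloor>z\<rfloor> < \<lfloor>w\<rfloor>")
    case True
    then show ?thesis by (intro floor_less_cancel) (simp only: fl)
  next
    case False
    then have eq: "\<lfloor>w\<rfloor> = \<lfloor>z\<rfloor>" using floor_mono[of z w] that by simp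
    then have lt: "frac z < frac w" using that unfolding frac_def by linarith
    then have "frac w \<noteq> 0" using frac_ge_0[of z] by linarith
    then have w: "w \<notin> \<int>" by simp
    show ?thesis
    proof (cases "z \<in> \<int>")
      case True
      then have "f z = of_int \<lfloor>z\<rfloor>" by (simp add: f_def floorwise_def)
      then show ?thesis unfolding f[OF w] eq using logistic_bounds(1) by simp
    next
      case False
      then have "logit (frac z) < logit (frac w)"
        by (simp only: logit_less_iff frac_bounds w lt not_False_eq_True)
      then show ?thesis unfolding f[OF False] f[OF w] eq by (simp add: order_aut_less_iff[OF g])
    qed
  qed
  moreover have "\<exists>z. y = f z" for y
  proof (cases "y \<in> \<int>")
    case False
    obtain u where u: "logit (frac y) = g u"
      using g unfolding order_aut_def surj_def by blast
    let ?z = "of_int \<lfloor>y\<rfloor> + logistic u"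
    have "f ?z = of_int \<lfloor>y\<rfloor> + logistic (g u)"
      unfolding f[OF unit(1)] unit(2,3) by simp
    also have "\<dots> = y"
      unfolding u[symmetric] logistic_logit[OF frac_bounds[OF False]] unfolding frac_def by linarith
    finally show ?thesis by (intro exI) (rule sym)
  next
    case True
    then show ?thesis by (intro exI) (rule fi[symmetric])
  qed
  ultimately show "order_aut f"
    unfolding order_aut_def strict_mono_def surj_def by blast
qed

text \<open>Integers are matched by translation. For two points inside gaps, induction matches their
  positions within the gaps, \<open>floorwise\<close> lifts that map, and an integer translation
  then moves one gap onto the other.\<close>

lemma lev_transitive:
  assumes "lev k s = lev k t"
  obtains g where "order_aut g" "\<forall>u. lev k (g u) = lev k u" "g s = t"
proof -
  have "\<exists>g. order_aut g \<and> (\<forall>u. lev k (g u) = lev k u) \<and> g s = t"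
    using assms
  proof (induction k arbitrary: s t)
    case 0
    then show ?case by (intro exI[of _ "\<lambda>x. x + (t - s)"]) (simp add: order_aut_translation)
  next
    case (Suc k)
    show ?case
    proof (cases "s \<in> \<int>")
      case True
      then have "t \<in> \<int>" using Suc.prems by (auto split: if_splits)
      then obtain n where "t - s = of_int n" using True by (metis Ints_cases Ints_diff)
      then have "t = s + of_int n" by simp
      then show ?thesis
        by (intro exI[of _ "\<lambda>x. x + of_int n"]) (simp add: order_aut_translation del: lev.simps)
    next
      case False
      then have t: "t \<notin> \<int>" and "lev k (logit (frac s)) = lev k (logit (frac t))"
        using Suc.prems by (auto split: if_splits)
      then obtain g where g: "order_aut g" "\<And>u. lev k (g u) = lev k u"
        "g (logit (frac s)) = logit (frac t)"
        using Suc.IH by blast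
      define f where "f = floorwise g"
      note f = order_aut_floorwise[OF g(1), folded f_def]
      have lev_f: "lev (Suc k) (f u) = lev (Suc k) u" for u
      proof (cases "u \<in> \<int>")
        case False
        then show ?thesis by (simp add: f(2)[OF False] f(3)[OF False] g(2))
      qed (simp add: f(4))
      have "f s = of_int \<lfloor>s\<rfloor> + frac t"
        using False by (simp only: f_def floorwise_def g(3) logistic_logit[OF frac_bounds[OF t]] if_False)
      then have "f s + of_int (\<lfloor>t\<rfloor> - \<lfloor>s\<rfloor>) = t" unfolding frac_def of_int_diff by linarith
      then show ?thesis
        using order_aut_comp[OF order_aut_translation f(1)] lev_f lev_add_of_int
        by (intro exI[of _ "\<lambda>z. f z + of_int (\<lfloor>t\<rfloor> - \<lfloor>s\<rfloor>)"] conjI allI) (simp_all only:)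
    qed
  qed
  then show ?thesis using that by blast
qed

section \<open>Orbits and height\<close>

definition orbit :: "('a \<Rightarrow> 'a) set \<Rightarrow> 'a \<Rightarrow> 'a set" where
  "orbit G x = (\<lambda>g. g x) ` G"

definition orbits :: "('a \<Rightarrow> 'a) set \<Rightarrow> 'a set \<Rightarrow> 'a set set" where
  "orbits G X = orbit G ` X"

lemma HomeoE:
  assumes "f \<in> Homeo X"
  obtains g where "homeomorphism X X f g"
  using assms unfolding Homeo_def by blast

lemma Homeo_outside: "f \<in> Homeo X \<Longrightarrow> x \<notin> X \<Longrightarrow> f x = x"
  by (simp add: Homeo_def)

lemma Homeo_in:
  assumes "f \<in> Homeo X" shows "f x \<in> X \<longleftrightarrow> x \<in> X"
proof -
  have "f ` X = X" using assms by (auto simp: Homeo_def homeomorphism_def)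
  then show ?thesis using Homeo_outside[OF assms] by (cases "x \<in> X") auto
qed

lemma Homeo_inj:
  assumes f: "f \<in> Homeo X" shows "inj f"
proof (rule injI)
  fix x y assume eq: "f x = f y"
  obtain g where g: "homeomorphism X X f g" using f by (rule HomeoE)
  have "x \<in> X \<longleftrightarrow> y \<in> X" using eq Homeo_in[OF f] by metis
  then show "x = y"
    using eq homeomorphism_apply1[OF g] Homeo_outside[OF f] by (cases "x \<in> X") (metis, metis)
qed

lemma Homeo_continuous: "f \<in> Homeo X \<Longrightarrow> continuous_on X f"
  by (auto simp: Homeo_def homeomorphism_def)

lemma Homeo_id: "id \<in> Homeo X"
  by (auto simp: Homeo_def intro!: exI[of _ id] homeomorphismI)

lemma Homeo_comp: "f \<in> Homeo X \<Longrightarrow> g \<in> Homeo X \<Longrightarrow> f \<circ> g \<in> Homeo X"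
  unfolding Homeo_def using homeomorphism_compose by fastforce

text \<open>The inverse supplied by \<open>homeomorphism\<close> is arbitrary off \<open>X\<close>;
  resetting it to the identity there keeps it in \<open>Homeo X\<close> and makes it an inverse on
  the whole type.\<close>

lemma Homeo_inverse:
  assumes "f \<in> Homeo X"
  obtains g where "g \<in> Homeo X" "homeomorphism X X f g" "\<forall>x. f (g x) = x" "\<forall>x. g (f x) = x"
proof -
  obtain h where h: "homeomorphism X X f h" using assms by (rule HomeoE)
  note out = Homeo_outside[OF assms]
  let ?g = "\<lambda>x. if x \<in> X then h x else x"
  have hom: "homeomorphism X X f ?g"
    using h by (auto simp: homeomorphism_def intro: continuous_on_eq)
  then have "?g \<in> Homeo X"
    by (auto simp: Homeo_def intro!: exI[of _ f] homeomorphism_symD)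
  then show ?thesis
  proof (rule that[OF _ hom])
    show "\<forall>x. f (?g x) = x" using h out by (auto simp: homeomorphism_def)
    show "\<forall>x. ?g (f x) = x" using h out by (auto simp: homeomorphism_def)
  qed
qed

lemma homeo_subgroup_Homeo: "homeo_subgroup X (Homeo X)"
  unfolding homeo_subgroup_def
proof (intro conjI ballI)
  show "\<exists>g\<in>Homeo X. homeomorphism X X f g" if "f \<in> Homeo X" for f
    using that by (rule Homeo_inverse) (rule bexI)
qed (simp_all add: Homeo_id Homeo_comp)

lemma homeo_subgroup_sub:
  assumes "homeo_subgroup X H" "id \<in> G" "G \<subseteq> H" "\<And>f g. f \<in> G \<Longrightarrow> g \<in> G \<Longrightarrow> f \<circ> g \<in> G"
    "\<And>f g. f \<in> G \<Longrightarrow> g \<in> H \<Longrightarrow> homeomorphism X X f g \<Longrightarrow> (\<And>x. x \<in> X \<Longrightarrow> f (g x) = x) \<Longrightarrow> g \<in> G"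
  shows "homeo_subgroup X G"
  unfolding homeo_subgroup_def
proof (intro conjI ballI)
  show "\<exists>g\<in>G. homeomorphism X X f g" if f: "f \<in> G" for f
  proof -
    have "\<exists>g\<in>H. homeomorphism X X f g"
      using assms(1,3) f by (auto simp: homeo_subgroup_def)
    then obtain g where g: "g \<in> H" "homeomorphism X X f g" by (rule bexE)
    have "g \<in> G" using assms(5)[OF f g] homeomorphism_apply2[OF g(2)] by simp
    then show ?thesis using g(2) by - (rule bexI)
  qed
qed (use assms in \<open>auto simp: homeo_subgroup_def\<close>)

lemma homeo_subgroup_subset: "homeo_subgroup X G \<Longrightarrow> f \<in> G \<Longrightarrow> f \<in> Homeo X"
  by (auto simp: homeo_subgroup_def)

lemma orbit_self: "homeo_subgroup X G \<Longrightarrow> x \<in> orbit G x"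
  unfolding orbit_def by (rule rev_image_eqI[of id]) (simp_all add: homeo_subgroup_def)

lemma orbit_subset: "homeo_subgroup X G \<Longrightarrow> x \<in> X \<Longrightarrow> orbit G x \<subseteq> X"
  by (auto simp: orbit_def Homeo_in homeo_subgroup_subset)

lemma orbit_apply:
  assumes "homeo_subgroup X G" "y \<in> orbit G x" "g \<in> G"
  shows "g y \<in> orbit G x"
proof -
  obtain f where f: "f \<in> G" "y = f x" using assms(2) by (auto simp: orbit_def)
  then have "g \<circ> f \<in> G" using assms by (simp add: homeo_subgroup_def)
  then show ?thesis unfolding orbit_def by (rule rev_image_eqI) (simp add: f(2))
qed

lemma orbit_sym:
  assumes "homeo_subgroup X G" "y \<in> orbit G x" "x \<in> X"
  shows "x \<in> orbit G y"
proof -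
  obtain g where g: "g \<in> G" "y = g x" using assms by (auto simp: orbit_def)
  have "\<exists>h\<in>G. homeomorphism X X g h" using assms(1) g(1) by (simp add: homeo_subgroup_def)
  then obtain h where h: "h \<in> G" "homeomorphism X X g h" by (rule bexE)
  show ?thesis
    unfolding orbit_def using h(1) by (rule rev_image_eqI) (simp add: g(2) homeomorphism_apply1[OF h(2) assms(3)])
qed

lemma orbit_eq:
  assumes "homeo_subgroup X G" "y \<in> orbit G x" "x \<in> X"
  shows "orbit G y = orbit G x"
proof -
  have "orbit G b \<subseteq> orbit G a" if "b \<in> orbit G a" for a b
    using orbit_apply[OF assms(1) that] by (auto simp: orbit_def)
  then show ?thesis using assms(2) orbit_sym[OF assms] by (intro equalityI)
qed

lemma orbits_disjoint:
  assumes G: "homeo_subgroup X G" and "A \<in> orbits G X" "B \<in> orbits G X" "z \<in> A" "z \<in> B"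
  shows "A = B"
proof -
  obtain a b where "a \<in> X" "b \<in> X" "A = orbit G a" "B = orbit G b"
    using assms(2,3) by (auto simp: orbits_def)
  then show ?thesis using orbit_eq[OF G, of z a] orbit_eq[OF G, of z b] assms(4,5) by simp
qed

lemma orbitsE:
  assumes "A \<in> orbits G X" obtains x where "x \<in> X" "A = orbit G x"
  using assms unfolding orbits_def by (elim imageE) (rule that)

lemma orbits_nonempty: "homeo_subgroup X G \<Longrightarrow> A \<in> orbits G X \<Longrightarrow> A \<noteq> {}"
  by (elim orbitsE) (use orbit_self in fast)

lemma orbits_subset: "homeo_subgroup X G \<Longrightarrow> A \<in> orbits G X \<Longrightarrow> A \<subseteq> X"
  by (elim orbitsE) (simp add: orbit_subset)

lemma orbits_apply: "homeo_subgroup X G \<Longrightarrow> A \<in> orbits G X \<Longrightarrow> y \<in> A \<Longrightarrow> g \<in> G \<Longrightarrow> g y \<in> A"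
  by (elim orbitsE) (simp add: orbit_apply)

lemma orbits_transitive:
  assumes "homeo_subgroup X G" "A \<in> orbits G X" "x \<in> A" "y \<in> A"
  obtains g where "g \<in> G" "g x = y"
proof -
  obtain a where a: "a \<in> X" "A = orbit G a" using assms(2) by (rule orbitsE)
  then have "y \<in> orbit G x" using assms(3,4) orbit_eq[OF assms(1), of x a] by simp
  then show ?thesis using that by (auto simp: orbit_def)
qed

lemma invariant_Union_orbits:
  assumes "homeo_subgroup X G" "invariant_set G X Y"
  shows "Y = \<Union>{A \<in> orbits G X. A \<subseteq> Y}"
proof (intro equalityI subsetI)
  fix y assume y: "y \<in> Y"
  then have "orbit G y \<in> orbits G X" "orbit G y \<subseteq> Y"
    using assms(2) by (auto simp: orbits_def invariant_set_def orbit_def)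
  then show "y \<in> \<Union>{A \<in> orbits G X. A \<subseteq> Y}" using orbit_self[OF assms(1)] by blast
qed blast

section \<open>Closures of orbits and chains of closed invariant sets\<close>

definition locally_closed_in :: "'a::topological_space set \<Rightarrow> 'a set \<Rightarrow> bool" where
  "locally_closed_in X S \<longleftrightarrow>
     (\<exists>A B. openin (top_of_set X) A \<and> openin (top_of_set X) B \<and> S = A - B)"

lemma locally_closed_in_open: "openin (top_of_set X) S \<Longrightarrow> locally_closed_in X S"
  unfolding locally_closed_in_def by (intro exI[of _ S] exI[of _ "{}"]) auto

lemma locally_closed_in_closed:
  assumes "closedin (top_of_set X) S" shows "locally_closed_in X S"
proof -
  have "openin (top_of_set X) (X - S)" "S = X - (X - S)"
    using assms by (auto simp: closedin_def)
  then show ?thesis unfolding locally_closed_in_def by blast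
qed

text \<open>By continuity every group element maps the closure of \<open>B\<close> into itself, and
  the group carries \<open>y\<close> to any point of \<open>A\<close>.\<close>

lemma orbit_meets_closure:
  assumes "homeo_subgroup X G" "closed X" "A \<in> orbits G X" "B \<in> orbits G X" "y \<in> A" "y \<in> closure B"
  shows "A \<subseteq> closure B"
proof
  fix z assume "z \<in> A"
  then obtain g where g: "g \<in> G" "g y = z" using orbits_transitive assms by blast
  have "closure B \<subseteq> X" using assms orbits_subset closure_minimal by metis
  then have "continuous_on (closure B) g"
    using Homeo_continuous homeo_subgroup_subset[OF assms(1) g(1)] continuous_on_subset by blast
  moreover have "g ` B \<subseteq> closure B"
    using orbits_apply[OF assms(1,4)] g(1) closure_subset by blast
  ultimately have "g ` closure B \<subseteq> closure B" by (intro image_closure_subset) auto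
  then show "z \<in> closure B" using assms g by blast
qed

text \<open>Write \<open>A\<close> as \<open>U - V\<close> with \<open>U\<close> and
  \<open>V\<close> open, relative to \<open>X\<close>. Since \<open>A\<close> lies in the closure of
  \<open>B\<close>, the set \<open>U\<close> meets \<open>B\<close>; since \<open>V\<close> misses
  \<open>A\<close>, it misses the closure of \<open>A\<close> and hence \<open>B\<close>. A point of
  \<open>B\<close> in \<open>U\<close> therefore lies in both orbits.\<close>

lemma orbits_closure_antisym:
  assumes "homeo_subgroup X G" "A \<in> orbits G X" "B \<in> orbits G X" "locally_closed_in X A"
    "A \<subseteq> closure B" "B \<subseteq> closure A"
  shows "A = B"
proof -
  obtain U V where UV: "open U" "open V" "A = (X \<inter> U) - (X \<inter> V)"
    using assms(4) by (auto simp: locally_closed_in_def openin_open)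
  obtain y where y: "y \<in> A" using orbits_nonempty assms by blast
  then have "U \<inter> B \<noteq> {}" using UV assms(5) open_Int_closure_eq_empty[of U B] by blast
  then obtain z where z: "z \<in> U" "z \<in> B" by blast
  have "V \<inter> A = {}" using UV by auto
  then have "V \<inter> closure A = {}" using open_Int_closure_eq_empty UV by blast
  then have "z \<notin> V" using z assms by blast
  then have "z \<in> A" using z UV orbits_subset assms by blast
  then show ?thesis using orbits_disjoint z assms by blast
qed

text \<open>An orbit whose closure contains as many orbits as possible avoids the closure of every other
  orbit, so it can be removed from a closed invariant set.\<close>

lemma removable_orbit:
  assumes G: "homeo_subgroup X G" and X: "closed X"
    and lc: "\<And>A. A \<in> orbits G X \<Longrightarrow> locally_closed_in X A"
    and P: "finite P" "P \<noteq> {}" "P \<subseteq> orbits G X"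
  obtains A where "A \<in> P" "\<And>B. B \<in> P \<Longrightarrow> B \<noteq> A \<Longrightarrow> A \<inter> closure B = {}"
proof -
  define c where "c = (\<lambda>A. card {B \<in> P. B \<subseteq> closure A})"
  have "Max (c ` P) \<in> c ` P" using P by simp
  then obtain A where A: "A \<in> P" "c A = Max (c ` P)" by (auto elim!: imageE)
  have max: "c B \<le> c A" if "B \<in> P" for B unfolding A(2) using P(1) that by simp
  have "A \<inter> closure B = {}" if B: "B \<in> P" "B \<noteq> A" for B
  proof (rule ccontr)
    assume "A \<inter> closure B \<noteq> {}"
    then have AB: "A \<subseteq> closure B"
      using orbit_meets_closure[OF G X] A B P by blast
    then have "\<not> B \<subseteq> closure A"
      using orbits_closure_antisym[OF G, of A B] A B P lc by blast
    moreover have "closure A \<subseteq> closure B" using AB by (simp add: closure_minimal)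
    ultimately have "{C \<in> P. C \<subseteq> closure A} \<subset> {C \<in> P. C \<subseteq> closure B}"
      using B closure_subset by blast
    then have "c A < c B" unfolding c_def using P by (intro psubset_card_mono) auto
    then show False using max[OF B(1)] by simp
  qed
  then show ?thesis using that A by blast
qed

text \<open>Orbits are removed from \<open>Y\<close> one at a time so that each remainder is closed.
  The chain has one step fewer than there are orbits because its smallest member must be
  nonempty.\<close>

lemma invariant_chain:
  assumes G: "homeo_subgroup X G" and X: "closed X"
    and lc: "\<And>A. A \<in> orbits G X \<Longrightarrow> locally_closed_in X A" and fin: "finite (orbits G X)"
    and "closed_invariant G X Y" "card {A \<in> orbits G X. A \<subseteq> Y} = Suc n"
  shows "\<exists>Z. (\<forall>i\<le>n. closed_invariant G X (Z i)) \<and> (\<forall>i<n. Z i \<subset> Z (Suc i)) \<and> Z n = Y"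
  using assms(5,6)
proof (induction n arbitrary: Y)
  case 0
  then show ?case by (intro exI[of _ "\<lambda>_. Y"]) auto
next
  case (Suc n)
  let ?P = "{A \<in> orbits G X. A \<subseteq> Y}"
  have Y: "invariant_set G X Y" "closed Y"
    using Suc.prems X by (auto simp: closed_invariant_def closedin_closed_eq)
  have P: "finite ?P" "?P \<noteq> {}"
    using fin Suc.prems(2) by (simp, metis card.empty nat.distinct(1))
  obtain A where A: "A \<in> ?P" and sep: "\<And>B. B \<in> ?P \<Longrightarrow> B \<noteq> A \<Longrightarrow> A \<inter> closure B = {}"
    using removable_orbit[OF G X lc P] by blast
  have YU: "Y = \<Union>?P" by (rule invariant_Union_orbits[OF G Y(1)])
  \<comment> \<open>Closures of the other orbits stay inside \<open>Y\<close> and avoid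
    \<open>A\<close>, so the remainder is a finite union of closed sets.\<close>
  have "Y - A = (\<Union>B\<in>?P - {A}. closure B)"
  proof (intro equalityI subsetI)
    fix x assume "x \<in> Y - A"
    then show "x \<in> (\<Union>B\<in>?P - {A}. closure B)" using YU closure_subset by blast
  next
    fix x assume "x \<in> (\<Union>B\<in>?P - {A}. closure B)"
    then show "x \<in> Y - A" using sep closure_minimal[OF _ Y(2)] by blast
  qed
  moreover have "closed (\<Union>B\<in>?P - {A}. closure B)" using P by (intro closed_UN) auto
  ultimately have cl: "closed (Y - A)" by simp
  have PA: "{B \<in> orbits G X. B \<subseteq> Y - A} = ?P - {A}"
  proof (intro equalityI subsetI)
    fix B assume "B \<in> {B \<in> orbits G X. B \<subseteq> Y - A}"
    then show "B \<in> ?P - {A}" using orbits_nonempty[OF G] A by blast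
  next
    fix B assume "B \<in> ?P - {A}"
    then show "B \<in> {B \<in> orbits G X. B \<subseteq> Y - A}" using orbits_disjoint[OF G] A by blast
  qed
  then have card: "card {B \<in> orbits G X. B \<subseteq> Y - A} = Suc n"
    using A P Suc.prems by simp
  then have ne: "Y - A \<noteq> {}" using orbits_nonempty[OF G] by (metis (no_types, lifting) card.empty
    empty_Collect_eq nat.distinct(1) subset_empty)
  have "g y \<in> Y - A" if g: "g \<in> G" and y: "y \<in> Y - A" for g y
  proof -
    obtain B where B: "B \<in> ?P - {A}" "y \<in> B" using y YU by blast
    then have "g y \<in> B" using orbits_apply[OF G] g by blast
    then show ?thesis using PA B(1) by blast
  qed
  then have ci: "closed_invariant G X (Y - A)"
    using ne cl Y X by (auto simp: closed_invariant_def invariant_set_def closedin_closed_eq)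
  obtain Z where Z: "\<forall>i\<le>n. closed_invariant G X (Z i)" "\<forall>i<n. Z i \<subset> Z (Suc i)" "Z n = Y - A"
    using Suc.IH[OF ci card] by blast
  have "Y - A \<subset> Y" using A orbits_nonempty[OF G] by blast
  then show ?case
    using Z Suc.prems(1) by (intro exI[of _ "\<lambda>i. if i \<le> n then Z i else Y"]) (auto simp: le_Suc_eq less_Suc_eq)
qed

text \<open>The lower bound peels all orbits off \<open>X\<close>. For the upper bound, a strict
  inclusion of invariant sets adds at least one orbit, and the smallest set already holds
  one.\<close>

lemma height_eq_card_orbits:
  assumes G: "homeo_subgroup X G" and X: "closed X" "X \<noteq> {}"
    and lc: "\<And>A. A \<in> orbits G X \<Longrightarrow> locally_closed_in X A" and fin: "finite (orbits G X)"
  shows "height G X = enat (card (orbits G X) - 1)"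
  unfolding height_def
proof (rule cSup_eq_maximum)
  have "orbits G X \<noteq> {}" using X by (auto simp: orbits_def)
  then have "card (orbits G X) > 0" using fin by (simp add: card_gt_0_iff)
  moreover have "{A \<in> orbits G X. A \<subseteq> X} = orbits G X" using orbits_subset[OF G] by blast
  ultimately have "card {A \<in> orbits G X. A \<subseteq> X} = Suc (card (orbits G X) - 1)" by simp
  moreover have "closed_invariant G X X"
    using X Homeo_in homeo_subgroup_subset[OF G] by (auto simp: closed_invariant_def invariant_set_def)
  ultimately show "enat (card (orbits G X) - 1) \<in> {enat n |n. \<exists>Y. (\<forall>i\<le>n. closed_invariant G X (Y i)) \<and>
      (\<forall>i<n. Y i \<subset> Y (Suc i)) \<and> Y n = X}"
    using invariant_chain[OF G X(1) lc fin] by simp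
next
  fix m assume "m \<in> {enat n |n. \<exists>Y. (\<forall>i\<le>n. closed_invariant G X (Y i)) \<and>
      (\<forall>i<n. Y i \<subset> Y (Suc i)) \<and> Y n = X}"
  then obtain n Y where n: "m = enat n" and Y: "\<forall>i\<le>n. closed_invariant G X (Y i)" "\<forall>i<n. Y i \<subset> Y (Suc i)"
    by (elim CollectE exE conjE) (rule that)
  note ci = Y(1)[rule_format] and less = Y(2)[rule_format]
  define P where "P = (\<lambda>i. {A \<in> orbits G X. A \<subseteq> Y i})"
  have YU: "Y i = \<Union>(P i)" if "i \<le> n" for i
    using invariant_Union_orbits[OF G] ci[OF that] by (simp add: P_def closed_invariant_def)
  have finP: "finite (P i)" for i using fin by (simp add: P_def)
  have "i < card (P i)" if "i \<le> n" for i
    using that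
  proof (induction i)
    case 0
    then have "Y 0 \<noteq> {}" using ci[of 0] by (auto simp: closed_invariant_def invariant_set_def)
    then have "P 0 \<noteq> {}" using YU[of 0] by auto
    then show ?case using finP by (simp add: card_gt_0_iff)
  next
    case (Suc i)
    then have lt: "Y i \<subset> Y (Suc i)" by (intro less) simp
    then have "P i \<subseteq> P (Suc i)" unfolding P_def by blast
    moreover have "\<Union>(P i) \<noteq> \<Union>(P (Suc i))"
      using lt YU[OF Suc.prems] YU[OF Suc_leD[OF Suc.prems]] by simp
    ultimately have "P i \<subset> P (Suc i)" by auto
    then have "card (P i) < card (P (Suc i))" using finP by (intro psubset_card_mono) auto
    then show ?case using Suc by simp
  qed
  then have "n < card (P n)" by simp
  also have "\<dots> \<le> card (orbits G X)" using fin by (intro card_mono) (auto simp: P_def)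
  finally show "m \<le> enat (card (orbits G X) - 1)" using n by simp
qed

section \<open>Heights of smaller groups\<close>

lemma height_mono:
  assumes "G \<subseteq> H" shows "height H X \<le> height G X"
  unfolding height_def
proof (rule Sup_subset_mono, rule subsetI)
  have ci: "closed_invariant G X Y" if "closed_invariant H X Y" for Y
    using that assms by (auto simp: closed_invariant_def invariant_set_def)
  fix m assume "m \<in> {enat n |n. \<exists>Y. (\<forall>i\<le>n. closed_invariant H X (Y i)) \<and>
      (\<forall>i<n. Y i \<subset> Y (Suc i)) \<and> Y n = X}"
  then show "m \<in> {enat n |n. \<exists>Y. (\<forall>i\<le>n. closed_invariant G X (Y i)) \<and>
      (\<forall>i<n. Y i \<subset> Y (Suc i)) \<and> Y n = X}"
  proof (elim CollectE exE conjE)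
    fix n Y
    assume "m = enat n" "\<forall>i\<le>n. closed_invariant H X (Y i)" "\<forall>i<n. Y i \<subset> Y (Suc i)" "Y n = X"
    then show ?thesis using ci by (intro CollectI exI[of _ n] exI[of _ Y] conjI) simp_all
  qed
qed

text \<open>Here every nonempty closed subset is invariant, so growing finite sets of distinct
  points, capped by \<open>X\<close>, give chains of any length.\<close>

lemma height_trivial_group:
  fixes X :: "'a::metric_space set"
  assumes "infinite X"
  shows "height {id} X = \<infinity>"
proof -
  have "enat n \<le> height {id} X" for n
  proof -
    obtain e :: "nat \<Rightarrow> 'a" where e: "inj e" "range e \<subseteq> X" using infinite_countable_subset[OF assms] by blast
    define Y where "Y = (\<lambda>i. if i < n then e ` {..i} else X)"
    have "closed_invariant {id} X (Y i)" for i
      using e assms by (auto simp: Y_def closed_invariant_def invariant_set_def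
          intro!: closed_subset finite_imp_closed)
    moreover have "Y i \<subset> Y (Suc i)" if "i < n" for i
    proof -
      have "e (Suc i) \<notin> e ` {..i}" using e by (auto simp: inj_eq)
      moreover have "e (Suc i) \<in> Y (Suc i)" "e ` {..i} \<subseteq> Y (Suc i)" using e by (auto simp: Y_def)
      ultimately show ?thesis using that by (auto simp: Y_def)
    qed
    moreover have "Y n = X" by (simp add: Y_def)
    ultimately show ?thesis unfolding height_def by (intro Sup_upper) blast
  qed
  then show ?thesis by (metis enat_ord_code(3) enat_ord_simps(1) infinity_ileE not_infinity_eq
    Suc_n_not_le_n)
qed

section \<open>Cell structures\<close>

lemma order_aut_continuous:
  assumes "order_aut g" shows "continuous_on S g"
proof -
  have "continuous_on UNIV g"
  proof (rule continuous_onI_mono)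
    show "open (g ` UNIV)" using assms by (simp add: order_aut_def)
    show "g x \<le> g y" if "x \<le> y" for x y
      using assms that by (simp add: order_aut_def strict_mono_less_eq)
  qed
  then show ?thesis by (rule continuous_on_subset) simp
qed

definition unit_ext :: "(real \<Rightarrow> real) \<Rightarrow> real \<Rightarrow> real" where
  "unit_ext g t = (if 0 < t \<and> t < 1 then logistic (g (logit t)) else t)"

lemma unit_ext_logistic [simp]: "unit_ext g (logistic t) = logistic (g t)"
  by (simp add: unit_ext_def logistic_bounds)

text \<open>Taken on the whole line instead of the unit interval, the map is monotone and onto,
  hence continuous. No limit at \<open>0\<close> or \<open>1\<close> has to be computed.\<close>

lemma order_aut_unit_ext:
  assumes g: "order_aut g" shows "order_aut (unit_ext g)"
proof -
  have "unit_ext g x < unit_ext g y" if xy: "x < y" for x y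
  proof (cases "0 < x \<and> x < 1 \<and> 0 < y \<and> y < 1")
    case True
    then have "logit x < logit y" using xy by (simp add: logit_less_iff)
    then show ?thesis using True by (simp add: unit_ext_def order_aut_less_iff[OF g])
  next
    case False
    have "unit_ext g x < y" if "0 < x" "x < 1" "\<not> (0 < y \<and> y < 1)"
      using that xy logistic_bounds(2)[of "g (logit x)"] by (simp add: unit_ext_def)
    moreover have "x < unit_ext g y" if "0 < y" "y < 1" "\<not> (0 < x \<and> x < 1)"
      using that xy logistic_bounds(1)[of "g (logit y)"] by (simp add: unit_ext_def)
    ultimately show ?thesis using False xy by (auto simp: unit_ext_def)
  qed
  moreover have "\<exists>x. y = unit_ext g x" for y
  proof (cases "0 < y \<and> y < 1")
    case True
    obtain u where u: "logit y = g u" using g unfolding order_aut_def surj_def by blast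
    have "unit_ext g (logistic u) = y" using True by (simp add: u[symmetric] logistic_logit)
    then show ?thesis by (intro exI) (rule sym)
  next
    case False
    then show ?thesis by (intro exI[of _ y]) (auto simp: unit_ext_def)
  qed
  ultimately show ?thesis unfolding order_aut_def strict_mono_def surj_def by blast
qed

lemma unit_ext_in:
  assumes "t \<in> {0..1}" shows "unit_ext g t \<in> {0..1}"
  using assms logistic_bounds[of "g (logit t)"] by (auto simp: unit_ext_def)

text \<open>Extending a function from the open cells is tested on each path separately; the ends of a path
  may coincide, so a path is only a quotient map onto its image.\<close>

lemma continuous_on_path_image:
  fixes p :: "real \<Rightarrow> 'a::t2_space" and f :: "'a \<Rightarrow> 'b::topological_space"
  assumes p: "path p" and c: "continuous_on {0..1} (f \<circ> p)"
  shows "continuous_on (path_image p) f"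
  unfolding continuous_on_closed_vimage[OF closed_path_image[OF p]]
proof (intro allI impI)
  fix B :: "'b set" assume "closed B"
  then have "closed ((f \<circ> p) -` B \<inter> {0..1})"
    using c continuous_on_closed_vimage[OF closed_atLeastAtMost] by blast
  then have "compact ({0..1} \<inter> ((f \<circ> p) -` B))"
    using compact_Int_closed[OF compact_Icc, of "(f \<circ> p) -` B \<inter> {0..1}" 0 1] by (simp add: Int_commute Int_left_commute)
  then have "compact (p ` ({0..1} \<inter> ((f \<circ> p) -` B)))"
    using p by (intro compact_continuous_image) (auto simp: path_def intro: continuous_on_subset)
  moreover have "p ` ({0..1} \<inter> ((f \<circ> p) -` B)) = f -` B \<inter> path_image p"
    by (auto simp: path_image_def)
  ultimately show "closed (f -` B \<inter> path_image p)" by (simp add: compact_imp_closed)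
qed

definition cell :: "(real \<Rightarrow> 'a) \<Rightarrow> 'a set" where
  "cell p = p ` {0<..<1}"

definition pt :: "(real \<Rightarrow> 'a) \<Rightarrow> real \<Rightarrow> 'a" where
  "pt p t = p (logistic t)"

lemma range_pt: "range (pt p) = cell p"
  unfolding cell_def range_logistic[symmetric] pt_def by (simp add: image_image)

lemma pt_in_cell [simp]: "pt p t \<in> cell p"
  using range_pt by fast

lemma path_image_cell: "path_image p = insert (pathstart p) (insert (pathfinish p) (cell p))"
proof -
  have "{0..1::real} = insert 0 (insert 1 {0<..<1})" by auto
  then show ?thesis by (simp add: path_image_def cell_def pathstart_def pathfinish_def)
qed

lemma cell_subset_path_image: "cell p \<subseteq> path_image p"
  by (auto simp: path_image_cell)

text \<open>Injectivity is asked on the open interval only, so that a cell may be a loop at one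
  vertex; otherwise erasing a vertex between two cells with the same other end would leave the
  class.\<close>

locale cell_structure =
  fixes X :: "'a::metric_space set" and V :: "'a set" and C :: "(real \<Rightarrow> 'a) set"
  assumes finite_V: "finite V" and finite_C: "finite C" and V_subset: "V \<subseteq> X"
    and X_eq: "X = (\<Union>p\<in>C. path_image p)"
    and path: "p \<in> C \<Longrightarrow> path p"
    and inj: "p \<in> C \<Longrightarrow> inj_on p {0<..<1}"
    and ends: "p \<in> C \<Longrightarrow> pathstart p \<in> V" "p \<in> C \<Longrightarrow> pathfinish p \<in> V"
    and cell_V: "p \<in> C \<Longrightarrow> cell p \<inter> V = {}"
    and cells_disjoint: "p \<in> C \<Longrightarrow> q \<in> C \<Longrightarrow> x \<in> cell p \<Longrightarrow> x \<in> cell q \<Longrightarrow> p = q"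
begin

lemma path_image_subset: "p \<in> C \<Longrightarrow> path_image p \<subseteq> X"
  unfolding X_eq by blast

lemma cell_subset: "p \<in> C \<Longrightarrow> cell p \<subseteq> X"
  using path_image_subset cell_subset_path_image by blast

lemma compact_X: "compact X"
  unfolding X_eq using finite_C path by (intro compact_UN) (auto intro: compact_path_image)

lemma closed_X: "closed X"
  by (rule compact_imp_closed[OF compact_X])

lemma X_cells: "X = V \<union> (\<Union>p\<in>C. cell p)"
proof
  show "X \<subseteq> V \<union> (\<Union>p\<in>C. cell p)" unfolding X_eq path_image_cell using ends by auto
  show "V \<union> (\<Union>p\<in>C. cell p) \<subseteq> X" using V_subset cell_subset by auto
qed

lemma cellE:
  assumes "x \<in> X" "x \<notin> V"
  obtains p t where "p \<in> C" "x = pt p t"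
proof -
  obtain p where p: "p \<in> C" "x \<in> cell p" using assms X_cells by auto
  then obtain t where "x = pt p t" unfolding range_pt[symmetric] by (auto elim!: rangeE)
  then show ?thesis using that p(1) by blast
qed

lemma pt_in: "p \<in> C \<Longrightarrow> pt p t \<in> X"
  using cell_subset pt_in_cell by blast

lemma pt_notin_V: "p \<in> C \<Longrightarrow> pt p t \<notin> V"
  using cell_V pt_in_cell by blast

lemma pt_eq_iff: "p \<in> C \<Longrightarrow> q \<in> C \<Longrightarrow> pt p s = pt q t \<longleftrightarrow> p = q \<and> s = t"
proof
  assume p: "p \<in> C" and q: "q \<in> C" and eq: "pt p s = pt q t"
  then have pq: "p = q" using cells_disjoint[OF p q] pt_in_cell by metis
  have "logistic s = logistic t"
    using eq by (intro inj_onD[OF inj[OF p]]) (simp_all add: pq pt_def logistic_bounds)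
  then show "p = q \<and> s = t" using pq by simp
qed simp

text \<open>What is left of \<open>X\<close> consists of the vertices and finitely many compact
  paths: another path meets this cell neither in its interior nor at its ends.\<close>

lemma openin_cell:
  assumes p: "p \<in> C" shows "openin (top_of_set X) (cell p)"
proof -
  let ?R = "V \<union> (\<Union>q\<in>C - {p}. path_image q)"
  have "closed ?R"
    using finite_C finite_V path by (intro closed_Un closed_UN finite_imp_closed) (auto intro: closed_path_image)
  moreover have "X - ?R = cell p"
  proof
    show "X - ?R \<subseteq> cell p" using X_cells cell_subset_path_image by blast
    have "x \<notin> path_image q" if x: "x \<in> cell p" and q: "q \<in> C" "q \<noteq> p" for x q
      using cells_disjoint[OF p q(1) x] q x ends[OF q(1)] cell_V[OF p] by (auto simp: path_image_cell)
    then show "cell p \<subseteq> X - ?R" using cell_V[OF p] cell_subset[OF p] by auto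
  qed
  ultimately show ?thesis by (metis Diff_eq open_Compl openin_open_Int)
qed

text \<open>A definite description, meaningful only at points of cells; facts about
  \<open>idx\<close> and \<open>coord\<close> are therefore phrased through
  \<open>pt\<close>.\<close>

definition idx :: "'a \<Rightarrow> real \<Rightarrow> 'a" where
  "idx x = (THE p. p \<in> C \<and> x \<in> cell p)"

definition coord :: "'a \<Rightarrow> real" where
  "coord x = (THE t. x = pt (idx x) t)"

lemma idx_pt [simp]: "p \<in> C \<Longrightarrow> idx (pt p t) = p"
  unfolding idx_def by (rule the_equality) (auto intro: cells_disjoint)

lemma coord_pt [simp]: "p \<in> C \<Longrightarrow> coord (pt p t) = t"
  unfolding coord_def by (rule the_equality) (auto simp: pt_eq_iff)

lemma continuous_on_pt: "p \<in> C \<Longrightarrow> continuous_on S (pt p)"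
  unfolding pt_def
  using path by (intro continuous_on_compose2[OF _ continuous_on_logistic, of "{0..1}" p])
    (auto simp: path_def logistic_bounds less_imp_le)

text \<open>The parametrisation of an open cell is a closed map onto the cell: a relatively closed
  set of parameters is cut out of a compact subset of \<open>{0..1}\<close>, and the two ends go to
  vertices, outside the cell. So the inverse is continuous even when the full path is a
  loop.\<close>

lemma continuous_on_coord:
  assumes p: "p \<in> C" shows "continuous_on (cell p) coord"
proof -
  let ?i = "the_inv_into {0<..<1} p"
  have "continuous_on (cell p) ?i"
  proof (rule continuous_on_inverse_closed_map)
    show "continuous_on {0<..<1} p"
      using path[OF p] by (auto simp: path_def intro: continuous_on_subset)
    show "p ` {0<..<1} = cell p" by (simp add: cell_def)
    show "?i (p t) = t" if "t \<in> {0<..<1}" for t using that inj[OF p] by (simp add: the_inv_into_f_f)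
    fix U assume "closedin (top_of_set {0<..<1::real}) U"
    then obtain B where B: "closed B" "U = {0<..<1} \<inter> B" by (auto simp: closedin_closed)
    have "p ` U = cell p \<inter> p ` ({0..1} \<inter> B)"
    proof
      show "p ` U \<subseteq> cell p \<inter> p ` ({0..1} \<inter> B)" using B(2) by (auto simp: cell_def)
      have "p t \<in> p ` U" if "p t \<in> cell p" "t \<in> {0..1} \<inter> B" for t
      proof -
        have "p 0 \<notin> cell p" "p 1 \<notin> cell p"
          using ends[OF p] cell_V[OF p] by (auto simp: pathstart_def pathfinish_def)
        then have "t \<noteq> 0" "t \<noteq> 1" using that by auto
        then show ?thesis using that B(2) by auto
      qed
      then show "cell p \<inter> p ` ({0..1} \<inter> B) \<subseteq> p ` U" by auto
    qed
    moreover have "closed (p ` ({0..1} \<inter> B))"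
      using path[OF p]
      by (intro compact_imp_closed compact_continuous_image[OF _ compact_Int_closed[OF compact_Icc B(1)]])
        (auto simp: path_def intro: continuous_on_subset)
    ultimately show "closedin (top_of_set (cell p)) (p ` U)" by (metis closedin_closed_Int)
  qed
  moreover have "?i ` cell p \<subseteq> {0<..<1}"
    using inj[OF p] by (auto simp: cell_def the_inv_into_f_f)
  ultimately have "continuous_on (cell p) (\<lambda>x. logit (?i x))"
    using continuous_on_compose2[OF continuous_on_logit] by blast
  moreover have "logit (?i x) = coord x" if "x \<in> cell p" for x
  proof -
    obtain t where "x = pt p t" using \<open>x \<in> cell p\<close> unfolding range_pt[symmetric] by (rule rangeE)
    then show ?thesis
      using p inj[OF p] logistic_bounds[of t] by (simp add: pt_def[of p t, symmetric])
        (simp add: pt_def the_inv_into_f_f)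
  qed
  ultimately show ?thesis by (rule continuous_on_eq)
qed

lemma openin_pt_image:
  assumes p: "p \<in> C" and U: "open U" shows "openin (top_of_set X) (pt p ` U)"
proof -
  have "pt p ` U = cell p \<inter> coord -` U"
  proof
    show "pt p ` U \<subseteq> cell p \<inter> coord -` U" using p by auto
    show "cell p \<inter> coord -` U \<subseteq> pt p ` U" using p unfolding range_pt[symmetric] by auto
  qed
  then have "openin (top_of_set (cell p)) (pt p ` U)"
    using continuous_openin_preimage_gen[OF continuous_on_coord[OF p] U] by simp
  then show ?thesis using openin_cell[OF p] by (rule openin_trans)
qed

lemma continuous_on_X:
  assumes "\<And>p. p \<in> C \<Longrightarrow> continuous_on {0..1} (f \<circ> p)"
  shows "continuous_on X f"
  unfolding X_eq using finite_C assms path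
  by (intro continuous_on_closed_Union) (auto intro: closed_path_image continuous_on_path_image)

section \<open>Homeomorphisms acting inside the cells\<close>

definition cell_map :: "((real \<Rightarrow> 'a) \<Rightarrow> real \<Rightarrow> real) \<Rightarrow> 'a \<Rightarrow> 'a" where
  "cell_map \<gamma> x = (if x \<in> X - V then pt (idx x) (\<gamma> (idx x) (coord x)) else x)"

lemma cell_map_pt [simp]: "p \<in> C \<Longrightarrow> cell_map \<gamma> (pt p t) = pt p (\<gamma> p t)"
  by (simp add: cell_map_def pt_in pt_notin_V)

lemma cell_map_outside: "x \<notin> X - V \<Longrightarrow> cell_map \<gamma> x = x"
  by (simp only: cell_map_def if_False)

text \<open>Vertices and cell points obey one formula in path parameters, which reduces continuity
  along each closed path to that of \<open>unit_ext\<close>.\<close>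

lemma cell_map_path:
  assumes p: "p \<in> C" and t: "t \<in> {0..1}"
  shows "cell_map \<gamma> (p t) = p (unit_ext (\<gamma> p) t)"
proof (cases "0 < t \<and> t < 1")
  case True
  then have "p t = pt p (logit t)" by (simp add: pt_def logistic_logit)
  then have "cell_map \<gamma> (p t) = pt p (\<gamma> p (logit t))" using p by simp
  then show ?thesis using True by (simp add: pt_def unit_ext_def)
next
  case False
  then have "t = 0 \<or> t = 1" using t by auto
  then have "p t \<in> V" using ends[OF p] by (auto simp: pathstart_def pathfinish_def)
  then show ?thesis using False by (simp only: cell_map_outside unit_ext_def if_False Diff_iff not_True_eq_False simp_thms)
qed

lemma continuous_on_cell_map:
  assumes "\<And>p. p \<in> C \<Longrightarrow> order_aut (\<gamma> p)"
  shows "continuous_on X (cell_map \<gamma>)"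
proof (rule continuous_on_X)
  fix p assume p: "p \<in> C"
  have "continuous_on {0..1} (p \<circ> unit_ext (\<gamma> p))"
    using order_aut_continuous[OF order_aut_unit_ext[OF assms[OF p]]] path[OF p] unit_ext_in
    by (intro continuous_on_compose) (auto simp: path_def intro: continuous_on_subset)
  then show "continuous_on {0..1} (cell_map \<gamma> \<circ> p)"
    by (rule continuous_on_eq) (simp add: cell_map_path[OF p])
qed

lemma cell_map_in:
  assumes "x \<in> X" shows "cell_map \<gamma> x \<in> X"
proof (cases "x \<in> V")
  case False
  then obtain p t where "p \<in> C" "x = pt p t" using assms by (elim cellE)
  then show ?thesis by (simp add: pt_in)
qed (simp add: cell_map_outside assms)

lemma cell_map_inverse:
  assumes "x \<in> X" "\<And>p t. p \<in> C \<Longrightarrow> \<delta> p (\<gamma> p t) = t"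
  shows "cell_map \<delta> (cell_map \<gamma> x) = x"
proof (cases "x \<in> V")
  case False
  then obtain p t where "p \<in> C" "x = pt p t" using assms(1) by (elim cellE)
  then show ?thesis by (simp add: assms(2))
qed (simp add: cell_map_outside)

lemma cell_map_Homeo:
  assumes g: "\<And>p. p \<in> C \<Longrightarrow> order_aut (\<gamma> p)"
  shows "cell_map \<gamma> \<in> Homeo X"
proof -
  let ?d = "\<lambda>p. inv (\<gamma> p)"
  have "homeomorphism X X (cell_map \<gamma>) (cell_map ?d)"
  proof (rule homeomorphismI)
    show "continuous_on X (cell_map \<gamma>)" by (rule continuous_on_cell_map[OF g])
    show "continuous_on X (cell_map ?d)" by (rule continuous_on_cell_map) (rule order_aut_inv[OF g])
    have b: "bij (\<gamma> p)" if "p \<in> C" for p by (rule order_aut_bij[OF g[OF that]])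
    show "cell_map ?d (cell_map \<gamma> x) = x" if "x \<in> X" for x
      using that by (rule cell_map_inverse) (simp add: inv_f_f[OF bij_is_inj[OF b]])
    show "cell_map \<gamma> (cell_map ?d x) = x" if "x \<in> X" for x
      using that by (rule cell_map_inverse) (simp add: surj_f_inv_f[OF bij_is_surj[OF b]])
  qed (auto simp: cell_map_in)
  then show ?thesis by (auto simp: Homeo_def cell_map_outside)
qed

text \<open>The cells are disjoint relatively open sets covering \<open>X - V\<close>, so a
  connected set off the vertices cannot meet two of them.\<close>

lemma connected_in_cell:
  assumes S: "connected S" "S \<subseteq> X - V" and p: "p \<in> C" "x \<in> S" "x \<in> cell p"
  shows "S \<subseteq> cell p"
proof -
  let ?R = "\<Union>q\<in>C - {p}. cell q"
  have "openin (top_of_set X) ?R" using openin_cell by (intro openin_Union) auto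
  then obtain A B where AB: "open A" "open B" "cell p = X \<inter> A" "?R = X \<inter> B"
    using openin_cell[OF p(1)] by (auto simp: openin_open)
  have cover: "X - V = cell p \<union> ?R" using X_cells cell_V p(1) by blast
  have disj: "cell p \<inter> ?R = {}" using cells_disjoint[OF p(1)] by blast
  have SX: "S \<subseteq> X" using S(2) by blast
  have "S \<inter> (A \<inter> B) \<subseteq> cell p \<inter> ?R" unfolding AB(3,4) using SX by blast
  then have "A \<inter> B \<inter> S = {}" unfolding disj by blast
  moreover have "S \<subseteq> cell p \<union> ?R" using cover S(2) by simp
  then have "S \<subseteq> A \<union> B" unfolding AB(3,4) by blast
  moreover have "A \<inter> S \<noteq> {}" using p(2,3) unfolding AB(3) by blast
  ultimately have "B \<inter> S = {}" using connectedD[OF S(1) AB(1,2)] by blast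
  then have "S \<inter> ?R = {}" unfolding AB(4) by blast
  then show ?thesis using \<open>S \<subseteq> cell p \<union> ?R\<close> by blast
qed

end

section \<open>Splitting an orbit\<close>

lemma openin_diff_locally_closed:
  assumes "openin (top_of_set X) A" "openin (top_of_set X) B" "S = A - B"
  shows "locally_closed_in X S"
  using assms unfolding locally_closed_in_def by (intro exI conjI)

lemma (in cell_structure) Homeo_cell_image:
  assumes f: "f \<in> Homeo X" and fV: "\<And>x. f x \<in> V \<longleftrightarrow> x \<in> V"
    and p: "p \<in> C" and q: "q \<in> C" and pq: "f (pt p s) \<in> cell q"
  shows "f ` cell p \<subseteq> cell q"
proof (rule connected_in_cell[OF _ _ q _ pq])
  have "connected (cell p)"
    unfolding range_pt[symmetric] using continuous_on_pt[OF p] by (intro connected_continuous_image) auto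
  then show "connected (f ` cell p)"
    using continuous_on_subset[OF Homeo_continuous[OF f] cell_subset[OF p]] by (intro connected_continuous_image)
  show "f ` cell p \<subseteq> X - V"
    using cell_subset[OF p] cell_V[OF p] fV Homeo_in[OF f] by auto
qed simp

text \<open>In coordinates \<open>f\<close> is a continuous bijection \<open>h\<close> of the line,
  hence strictly monotone. Precomposing with the inverse of \<open>h\<close> or of
  \<open>- h\<close> leaves the identity or the negation; using \<open>- h\<close> in the decreasing
  case keeps \<open>g\<close> order preserving.\<close>

lemma (in cell_structure) Homeo_cell_coord:
  assumes f: "f \<in> Homeo X" and fV: "\<And>x. f x \<in> V \<longleftrightarrow> x \<in> V"
    and p: "p \<in> C" and q: "q \<in> C" and pq: "f (pt p s) \<in> cell q"
  obtains g e where "order_aut g" "e = (\<lambda>t. t) \<or> e = uminus" "\<forall>t. f (pt p (g t)) = pt q (e t)"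
proof -
  obtain f' where f': "f' \<in> Homeo X" "homeomorphism X X f f'" "\<forall>x. f (f' x) = x" "\<forall>x. f' (f x) = x"
    using f by (rule Homeo_inverse)
  have f'V: "f' x \<in> V \<longleftrightarrow> x \<in> V" for x using fV[of "f' x"] f'(3) by simp
  define h where "h = (\<lambda>t. coord (f (pt p t)))"
  have fh: "f (pt p t) = pt q (h t)" for t
  proof -
    have "f (pt p t) \<in> cell q" using Homeo_cell_image[OF f fV p q pq] by auto
    then obtain u where "f (pt p t) = pt q u" unfolding range_pt[symmetric] by (rule rangeE)
    then show ?thesis using q by (simp add: h_def)
  qed
  have "f' (pt q (h s)) \<in> cell p" unfolding fh[symmetric] using f'(4) by simp
  then have back_sub: "f' ` cell q \<subseteq> cell p" by (rule Homeo_cell_image[OF f'(1) f'V q p])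
  have surj: "surj h"
    unfolding surj_def
  proof
    fix u
    have "f' (pt q u) \<in> cell p" using back_sub by auto
    then obtain t where "f' (pt q u) = pt p t" unfolding range_pt[symmetric] by (rule rangeE)
    then have "pt q u = pt q (h t)" using fh[of t] f'(3)[THEN spec, of "pt q u"] by simp
    then show "\<exists>t. u = h t" using q by (auto simp: pt_eq_iff)
  qed
  have "inj h"
  proof (rule injI)
    fix a b assume "h a = h b"
    then have "f (pt p a) = f (pt p b)" by (simp add: fh)
    then have "pt p a = pt p b" using injD[OF Homeo_inj[OF f]] by blast
    then show "a = b" using p by (simp add: pt_eq_iff)
  qed
  moreover have "continuous_on UNIV h"
  proof -
    have "continuous_on (range (pt p)) f"
      unfolding range_pt by (rule continuous_on_subset[OF Homeo_continuous[OF f] cell_subset[OF p]])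
    then have "continuous_on UNIV (f \<circ> pt p)"
      by (rule continuous_on_compose[OF continuous_on_pt[OF p]])
    moreover have "range (f \<circ> pt p) \<subseteq> cell q" by (auto simp: fh)
    then have "continuous_on (range (f \<circ> pt p)) coord"
      by (rule continuous_on_subset[OF continuous_on_coord[OF q]])
    ultimately have "continuous_on UNIV (coord \<circ> (f \<circ> pt p))" by (rule continuous_on_compose)
    then show ?thesis by (simp add: h_def o_def)
  qed
  ultimately have "strict_mono_on UNIV h \<or> strict_antimono_on UNIV h"
    using injective_eq_monotone_map[of UNIV h] by simp
  then show thesis
  proof
    assume "strict_mono_on UNIV h"
    then have h: "order_aut h" using surj by (simp add: order_aut_def)
    have "f (pt p (inv h t)) = pt q t" for t by (simp add: fh surj_f_inv_f[OF surj])
    then show thesis using that[OF order_aut_inv[OF h], of "\<lambda>t. t"] by simp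
  next
    assume "strict_antimono_on UNIV h"
    then have h: "order_aut (\<lambda>x. - h x)" using surj by (rule order_aut_uminus)
    let ?m = "\<lambda>x. - h x"
    have "- h (inv ?m t) = t" for t by (rule surj_f_inv_f[OF bij_is_surj[OF order_aut_bij[OF h]], of t])
    then have "h (inv ?m t) = - t" for t by (metis minus_minus)
    then have "f (pt p (inv ?m t)) = pt q (- t)" for t by (simp add: fh)
    then show thesis using that[OF order_aut_inv[OF h], of uminus] by simp
  qed
qed

text \<open>Stated for a subgroup \<open>H\<close> rather than for \<open>Homeo X\<close>, since on
  the circle it is applied to the stabilizer of the vertex. Containing the maps
  \<open>cell_map\<close> forces each cell into a single orbit.\<close>

locale cell_group = cell_structure +
  fixes H
  assumes H: "homeo_subgroup X H"
    and cell_map_H: "(\<And>p. p \<in> C \<Longrightarrow> order_aut (\<gamma> p)) \<Longrightarrow> cell_map \<gamma> \<in> H"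
    and H_V: "f \<in> H \<Longrightarrow> x \<in> V \<Longrightarrow> f x \<in> V"
begin

lemma H_Homeo: "f \<in> H \<Longrightarrow> f \<in> Homeo X"
  by (rule homeo_subgroup_subset[OF H])

lemma H_comp: "f \<in> H \<Longrightarrow> g \<in> H \<Longrightarrow> f \<circ> g \<in> H"
  using H by (simp add: homeo_subgroup_def)

text \<open>An injective map of the finite set \<open>V\<close> into itself is onto, so no point
  outside \<open>V\<close> can be mapped into it.\<close>

lemma H_V_iff:
  assumes f: "f \<in> H" shows "f x \<in> V \<longleftrightarrow> x \<in> V"
proof
  have inj: "inj f" by (rule Homeo_inj[OF H_Homeo[OF f]])
  have "f ` V = V"
    using H_V[OF f] finite_V inj by (intro endo_inj_surj) (auto intro: inj_on_subset)
  moreover assume "f x \<in> V"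
  ultimately obtain v where "v \<in> V" "f x = f v" by (metis imageE)
  then show "x \<in> V" using injD[OF inj] by metis
qed (rule H_V[OF f])

text \<open>Translations of the coordinate belong to \<open>H\<close> and act transitively on a
  cell.\<close>

lemma cell_in_orbit:
  assumes p: "p \<in> C" and A: "A \<in> orbits H X" and s: "pt p s \<in> A"
  shows "cell p \<subseteq> A"
proof -
  have "pt p t \<in> A" for t
  proof -
    let ?f = "cell_map (\<lambda>_ x. x + (t - s))"
    have "?f \<in> H" by (rule cell_map_H) (rule order_aut_translation)
    then have "?f (pt p s) \<in> A" by (rule orbits_apply[OF H A s])
    then show ?thesis using p by simp
  qed
  then show ?thesis unfolding range_pt[symmetric] by auto
qed

lemma orbit_disjoint_V:
  assumes p: "p \<in> C" and A: "A \<in> orbits H X" and s: "pt p s \<in> A"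
  shows "A \<inter> V = {}"
proof -
  have "v \<notin> V" if v: "v \<in> A" for v
  proof -
    obtain f where "f \<in> H" "f (pt p s) = v" using H A s v by (rule orbits_transitive)
    then show ?thesis using H_V_iff[of f "pt p s"] pt_notin_V[OF p, of s] by simp
  qed
  then show ?thesis by blast
qed

lemma orbit_eq_Union_cells:
  assumes p: "p \<in> C" and A: "A \<in> orbits H X" and s: "pt p s \<in> A"
  shows "A = (\<Union>q\<in>{q \<in> C. cell q \<subseteq> A}. range (pt q))"
proof
  show "A \<subseteq> (\<Union>q\<in>{q \<in> C. cell q \<subseteq> A}. range (pt q))"
  proof
    fix x assume x: "x \<in> A"
    then have "x \<in> X" "x \<notin> V" using orbits_subset[OF H A] orbit_disjoint_V[OF assms] by auto
    then obtain q t where q: "q \<in> C" "x = pt q t" by (rule cellE)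
    then have "cell q \<subseteq> A" using cell_in_orbit[OF q(1) A] x by simp
    then show "x \<in> (\<Union>q\<in>{q \<in> C. cell q \<subseteq> A}. range (pt q))" using q by auto
  qed
qed (auto simp: range_pt)

lemma orbit_open:
  assumes p: "p \<in> C" and A: "A \<in> orbits H X" and s: "pt p s \<in> A"
  shows "openin (top_of_set X) A"
proof (subst orbit_eq_Union_cells[OF assms], rule openin_Union)
  show "openin (top_of_set X) S" if "S \<in> (\<lambda>q. range (pt q)) ` {q \<in> C. cell q \<subseteq> A}" for S
    using that openin_pt_image[OF _ open_UNIV] by auto
qed

text \<open>An orbit inside \<open>V\<close> is finite and so closed; any other orbit is a union of
  cells and so open.\<close>

lemma orbits_locally_closed:
  assumes A: "A \<in> orbits H X" shows "locally_closed_in X A"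
proof (cases "A \<subseteq> V")
  case True
  then have "finite A" using finite_V by (rule finite_subset)
  then have "closedin (top_of_set X) A"
    using orbits_subset[OF H A] by (intro closed_subset finite_imp_closed)
  then show ?thesis by (rule locally_closed_in_closed)
next
  case False
  then obtain x where x: "x \<in> A" "x \<notin> V" by blast
  then have "x \<in> X" using orbits_subset[OF H A] by blast
  then obtain p t where "p \<in> C" "x = pt p t" using x(2) by (rule cellE)
  then have "openin (top_of_set X) A" using orbit_open[OF _ A] x(1) by blast
  then show ?thesis by (rule locally_closed_in_open)
qed

lemma finite_orbits: "finite (orbits H X)"
proof (rule finite_subset)
  show "orbits H X \<subseteq> orbit H ` V \<union> (\<lambda>p. orbit H (pt p 0)) ` C"
  proof
    fix A assume A: "A \<in> orbits H X"
    then obtain x where x: "x \<in> X" "A = orbit H x" by (rule orbitsE)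
    show "A \<in> orbit H ` V \<union> (\<lambda>p. orbit H (pt p 0)) ` C"
    proof (cases "x \<in> V")
      case False
      with x(1) obtain p t where p: "p \<in> C" "x = pt p t" by (rule cellE)
      then have "pt p t \<in> A" using x orbit_self[OF H] by simp
      then have "pt p 0 \<in> A" using cell_in_orbit[OF p(1) A] pt_in_cell by blast
      then have "A = orbit H (pt p 0)" using orbit_eq[OF H, of "pt p 0" x] x by simp
      then show ?thesis using p(1) by simp
    qed (simp add: x)
  qed
  show "finite (orbit H ` V \<union> (\<lambda>p. orbit H (pt p 0)) ` C)" using finite_V finite_C by simp
qed

text \<open>Off the cells \<open>coord\<close> is an unspecified real; only the values on an orbit
  made of cells matter.\<close>

definition level :: "nat \<Rightarrow> 'a \<Rightarrow> nat" where
  "level k x = lev k (coord x)"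

lemma level_pt [simp]: "p \<in> C \<Longrightarrow> level k (pt p t) = lev k t"
  by (simp add: level_def)

lemma level_le: "level k x \<le> k"
  by (simp add: level_def lev_le)

text \<open>Only the points of \<open>D\<close> constrain a map, so that on the other orbits the
  action can remain as rich as that of \<open>H\<close>.\<close>

definition level_group :: "nat \<Rightarrow> 'a set \<Rightarrow> ('a \<Rightarrow> 'a) set" where
  "level_group k D = {f \<in> H. \<forall>x\<in>D. level k (f x) = level k x}"

lemma homeo_subgroup_level_group:
  assumes D: "D \<in> orbits H X" shows "homeo_subgroup X (level_group k D)"
proof (rule homeo_subgroup_sub[OF H])
  show "id \<in> level_group k D" using H by (simp add: level_group_def homeo_subgroup_def)
  show "f \<circ> g \<in> level_group k D" if "f \<in> level_group k D" "g \<in> level_group k D" for f g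
    using that H_comp orbits_apply[OF H D] by (simp add: level_group_def)
  show "g \<in> level_group k D"
    if f: "f \<in> level_group k D" and g: "g \<in> H" and fg: "\<And>x. x \<in> X \<Longrightarrow> f (g x) = x" for f g
  proof -
    have "level k (g x) = level k x" if x: "x \<in> D" for x
    proof -
      have "g x \<in> D" by (rule orbits_apply[OF H D x g])
      then have "level k (f (g x)) = level k (g x)" using f by (simp add: level_group_def)
      moreover have "f (g x) = x" using subsetD[OF orbits_subset[OF H D] x] by (rule fg)
      ultimately show ?thesis by simp
    qed
    then show ?thesis using g by (simp add: level_group_def)
  qed
qed (auto simp: level_group_def)

text \<open>Every element of \<open>H\<close> can be straightened on the cells of an orbit, where it then acts as
  plus or minus the identity in the coordinates and so preserves levels.\<close>

lemma straighten:
  assumes D: "D \<in> orbits H X" "D \<inter> V = {}" and f: "f \<in> H"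
  obtains f' where "f' \<in> level_group k D" "\<forall>x. x \<notin> D \<longrightarrow> f' x = f x"
    "\<forall>p\<in>C. \<forall>q\<in>C. \<forall>t. cell p \<subseteq> D \<longrightarrow> f (pt p 0) \<in> cell q \<longrightarrow> f' (pt p t) \<in> cell q"
proof -
  have ex: "\<exists>g q e. order_aut g \<and> q \<in> C \<and> (e = (\<lambda>t. t) \<or> e = uminus) \<and> (\<forall>t. f (pt p (g t)) = pt q (e t))"
    if p: "p \<in> C" for p
  proof -
    have "f (pt p 0) \<in> X" "f (pt p 0) \<notin> V"
      using p by (simp_all add: H_V_iff[OF f] pt_notin_V Homeo_in[OF H_Homeo[OF f]] pt_in)
    then obtain q u where q: "q \<in> C" "f (pt p 0) = pt q u" by (rule cellE)
    then have "f (pt p 0) \<in> cell q" by simp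
    then obtain g e where "order_aut g" "e = (\<lambda>t. t) \<or> e = uminus" "\<forall>t. f (pt p (g t)) = pt q (e t)"
      by (rule Homeo_cell_coord[OF H_Homeo[OF f] H_V_iff[OF f] p q(1)])
    then show ?thesis using q(1) by blast
  qed
  obtain g where "\<forall>p\<in>C. \<exists>q e. order_aut (g p) \<and> q \<in> C \<and> (e = (\<lambda>t. t) \<or> e = uminus) \<and>
      (\<forall>t. f (pt p (g p t)) = pt q (e t))"
    using bchoice[OF ballI[OF ex]] by (rule exE)
  from bchoice[OF this] obtain q where "\<forall>p\<in>C. \<exists>e. order_aut (g p) \<and> q p \<in> C \<and>
      (e = (\<lambda>t. t) \<or> e = uminus) \<and> (\<forall>t. f (pt p (g p t)) = pt (q p) (e t))"
    by (rule exE)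
  from bchoice[OF this] obtain e where choice: "\<forall>p\<in>C. order_aut (g p) \<and> q p \<in> C \<and>
      (e p = (\<lambda>t. t) \<or> e p = uminus) \<and> (\<forall>t. f (pt p (g p t)) = pt (q p) (e p t))"
    by (rule exE)
  have g: "order_aut (g p)" and q: "q p \<in> C" and e: "e p = (\<lambda>t. t) \<or> e p = uminus"
    and f_eq: "f (pt p (g p t)) = pt (q p) (e p t)" if "p \<in> C" for p t
    using choice that by simp_all
  \<comment> \<open>Cells outside \<open>D\<close> are left alone, so that the straightened map
    agrees with \<open>f\<close> off \<open>D\<close>.\<close>
  define \<gamma> where "\<gamma> = (\<lambda>p. if cell p \<subseteq> D then g p else (\<lambda>t. t))"
  define f' where "f' = f \<circ> cell_map \<gamma>"
  have "order_aut (\<gamma> p)" if "p \<in> C" for p using g[OF that] by (simp add: \<gamma>_def)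
  then have "cell_map \<gamma> \<in> H" by (rule cell_map_H)
  then have f'H: "f' \<in> H" unfolding f'_def by (rule H_comp[OF f])
  have f'_pt: "f' (pt p t) = pt (q p) (e p t)" if "p \<in> C" "cell p \<subseteq> D" for p t
    using that f_eq by (simp add: f'_def \<gamma>_def)
  show thesis
  proof (rule that)
    have "level k (f' x) = level k x" if x: "x \<in> D" for x
    proof -
      have "x \<in> X" "x \<notin> V" using x orbits_subset[OF H D(1)] D(2) by auto
      then obtain p t where p: "p \<in> C" "x = pt p t" by (rule cellE)
      then have "cell p \<subseteq> D" using cell_in_orbit[OF p(1) D(1)] x by simp
      then have "f' x = pt (q p) (e p t)" using f'_pt[OF p(1)] p(2) by simp
      then show ?thesis using e[OF p(1)] p q[OF p(1)] by auto
    qed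
    then show "f' \<in> level_group k D" using f'H by (simp add: level_group_def)
    have "f' x = f x" if "x \<notin> D" for x
    proof (cases "x \<in> X - V")
      case True
      then have "x \<in> X" "x \<notin> V" by auto
      then obtain p t where p: "p \<in> C" "x = pt p t" by (rule cellE)
      then have "\<not> cell p \<subseteq> D" using that pt_in_cell by blast
      then show ?thesis using p by (simp add: f'_def \<gamma>_def)
    qed (simp add: f'_def cell_map_outside)
    then show "\<forall>x. x \<notin> D \<longrightarrow> f' x = f x" by blast
    \<comment> \<open>The correction stays within each cell, so the target cell is still the one
      chosen by \<open>f\<close>.\<close>
    have "f' (pt p t) \<in> cell r"
      if "p \<in> C" "r \<in> C" "cell p \<subseteq> D" "f (pt p 0) \<in> cell r" for p r t
    proof -
      have "f ` cell p \<subseteq> cell r"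
        by (rule Homeo_cell_image[OF H_Homeo[OF f] H_V_iff[OF f] that(1,2,4)])
      moreover have "f' (pt p t) = f (pt p (g p t))" using that by (simp add: f'_def \<gamma>_def)
      ultimately show ?thesis by auto
    qed
    then show "\<forall>p\<in>C. \<forall>r\<in>C. \<forall>t. cell p \<subseteq> D \<longrightarrow> f (pt p 0) \<in> cell r \<longrightarrow> f' (pt p t) \<in> cell r"
      by blast
  qed
qed

text \<open>An element of \<open>H\<close> taking the cell of \<open>x\<close> to that of
  \<open>y\<close> preserves levels once straightened. It remains to move the image of
  \<open>x\<close> to \<open>y\<close> inside one cell by a level-preserving order
  automorphism.\<close>

lemma level_group_transitive:
  assumes D: "D \<in> orbits H X" "D \<inter> V = {}"
    and x: "x \<in> D" and y: "y \<in> D" and xy: "level k x = level k y"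
  obtains f where "f \<in> level_group k D" "f x = y"
proof -
  have "x \<in> X" "x \<notin> V" "y \<in> X" "y \<notin> V" using x y orbits_subset[OF H D(1)] D(2) by auto
  obtain p s where p: "p \<in> C" "x = pt p s" using \<open>x \<in> X\<close> \<open>x \<notin> V\<close> by (rule cellE)
  obtain q t where q: "q \<in> C" "y = pt q t" using \<open>y \<in> X\<close> \<open>y \<notin> V\<close> by (rule cellE)
  have pD: "cell p \<subseteq> D" and qD: "cell q \<subseteq> D"
    using cell_in_orbit[OF p(1) D(1)] cell_in_orbit[OF q(1) D(1)] x y p(2) q(2) by simp_all
  obtain f where f: "f \<in> H" "f (pt p 0) = pt q 0"
    using H D(1) subsetD[OF pD pt_in_cell] subsetD[OF qD pt_in_cell] by (rule orbits_transitive)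
  obtain f' where f': "f' \<in> level_group k D"
    "\<forall>p\<in>C. \<forall>q\<in>C. \<forall>t. cell p \<subseteq> D \<longrightarrow> f (pt p 0) \<in> cell q \<longrightarrow> f' (pt p t) \<in> cell q"
    using D f(1) by (rule straighten)
  have "f (pt p 0) \<in> cell q" by (simp add: f(2))
  then have "f' (pt p s) \<in> cell q" using f'(2) p(1) q(1) pD by blast
  then obtain u where u: "f' x = pt q u" unfolding range_pt[symmetric] p(2) by (rule rangeE)
  have "lev k u = lev k t"
  proof -
    have "level k (f' x) = level k x" using f'(1) x by (simp add: level_group_def)
    then show ?thesis using u xy q by simp
  qed
  then obtain g where g: "order_aut g" "\<forall>v. lev k (g v) = lev k v" "g u = t" by (rule lev_transitive)
  define c where "c = cell_map (\<lambda>r. if r = q then g else (\<lambda>v. v))"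
  have "c \<in> H" unfolding c_def by (rule cell_map_H) (simp add: g(1))
  moreover have "level k (c z) = level k z" if "z \<in> D" for z
  proof -
    have "z \<in> X" "z \<notin> V" using \<open>z \<in> D\<close> orbits_subset[OF H D(1)] D(2) by auto
    then obtain r v where "r \<in> C" "z = pt r v" by (rule cellE)
    then show ?thesis using g(2) by (simp add: c_def)
  qed
  ultimately have "c \<in> level_group k D" by (simp add: level_group_def)
  then have "c \<circ> f' \<in> level_group k D"
    using homeo_subgroup_level_group[OF D(1)] f'(1) by (simp add: homeo_subgroup_def)
  moreover have "(c \<circ> f') x = y" using q g(3) by (simp add: u c_def)
  ultimately show thesis by (rule that)
qed

text \<open>On \<open>D\<close> the level is an invariant and, by transitivity, the only one. Off
  \<open>D\<close> every element of \<open>H\<close> agrees with a straightened one, so no other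
  orbit breaks up.\<close>

lemma orbits_level_group:
  assumes D: "D \<in> orbits H X" "D \<inter> V = {}"
  shows "orbits (level_group k D) X = (orbits H X - {D}) \<union> (\<lambda>j. {x \<in> D. level k x = j}) ` {..k}"
    (is "?L = ?R")
proof -
  note G = homeo_subgroup_level_group[OF D(1), of k]
  have GH: "level_group k D \<subseteq> H" by (auto simp: level_group_def)
  have inside: "orbit (level_group k D) x = {y \<in> D. level k y = level k x}" if x: "x \<in> D" for x
  proof
    show "orbit (level_group k D) x \<subseteq> {y \<in> D. level k y = level k x}"
      using orbits_apply[OF H D(1) x] x by (auto simp: orbit_def level_group_def)
    show "{y \<in> D. level k y = level k x} \<subseteq> orbit (level_group k D) x"
    proof
      fix y assume "y \<in> {y \<in> D. level k y = level k x}"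
      then have "y \<in> D" "level k x = level k y" by auto
      then obtain f where "f \<in> level_group k D" "f x = y" by (rule level_group_transitive[OF D x])
      then show "y \<in> orbit (level_group k D) x" by (auto simp: orbit_def)
    qed
  qed
  have outside: "orbit (level_group k D) x = orbit H x" if x: "x \<notin> D" for x
  proof
    show "orbit (level_group k D) x \<subseteq> orbit H x" using GH by (auto simp: orbit_def)
    show "orbit H x \<subseteq> orbit (level_group k D) x"
    proof
      fix y assume "y \<in> orbit H x"
      then obtain f where f: "f \<in> H" "y = f x" by (auto simp: orbit_def)
      obtain f' where "f' \<in> level_group k D" "\<forall>z. z \<notin> D \<longrightarrow> f' z = f z"
        using D f(1) by (rule straighten)
      then have "f' \<in> level_group k D" "f' x = y" using x f(2) by simp_all
      then show "y \<in> orbit (level_group k D) x" by (auto simp: orbit_def)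
    qed
  qed
  have DX: "D \<subseteq> X" by (rule orbits_subset[OF H D(1)])
  show ?thesis
  proof
    show "?L \<subseteq> ?R"
    proof
      fix A assume "A \<in> ?L"
      then obtain x where x: "x \<in> X" "A = orbit (level_group k D) x" by (rule orbitsE)
      show "A \<in> ?R"
      proof (cases "x \<in> D")
        case True
        then show ?thesis using x inside level_le[of k x] by auto
      next
        case False
        then have "A = orbit H x" using x(2) outside by simp
        moreover have "x \<in> orbit H x" by (rule orbit_self[OF H])
        ultimately show ?thesis using False x(1) by (auto simp: orbits_def)
      qed
    qed
    have "orbits H X - {D} \<subseteq> ?L"
    proof
      fix A assume A: "A \<in> orbits H X - {D}"
      then obtain x where x: "x \<in> X" "A = orbit H x" by (elim DiffE orbitsE)
      then have "x \<in> A" using orbit_self[OF H] by simp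
      then have "x \<notin> D" using orbits_disjoint[OF H _ D(1)] A by blast
      then show "A \<in> ?L" using x outside by (auto simp: orbits_def)
    qed
    moreover have "{x \<in> D. level k x = j} \<in> ?L" if j: "j \<le> k" for j
    proof -
      obtain z where z: "z \<in> D" using orbits_nonempty[OF H D(1)] by blast
      then have "z \<in> X" "z \<notin> V" using DX D(2) by auto
      then obtain p s where p: "p \<in> C" "z = pt p s" by (rule cellE)
      then have "cell p \<subseteq> D" using cell_in_orbit[OF p(1) D(1)] z by simp
      then have D_t: "pt p t \<in> D" for t using pt_in_cell by blast
      obtain t where "lev k t = j" using lev_surj[OF j] by (rule exE)
      then have "orbit (level_group k D) (pt p t) = {x \<in> D. level k x = j}"
        using inside[OF D_t] p(1) by simp
      then show ?thesis using DX D_t by (auto simp: orbits_def intro!: image_eqI[of _ _ "pt p t"])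
    qed
    ultimately show "?R \<subseteq> ?L" by auto
  qed
qed

text \<open>The orbit \<open>D\<close> is traded for \<open>k + 1\<close> distinct nonempty pieces,
  a net gain of \<open>k\<close>.\<close>

lemma card_orbits_level_group:
  assumes D: "D \<in> orbits H X" "D \<inter> V = {}"
  shows "finite (orbits (level_group k D) X)"
    and "card (orbits (level_group k D) X) = card (orbits H X) + k"
proof -
  let ?M = "\<lambda>j. {x \<in> D. level k x = j}"
  show "finite (orbits (level_group k D) X)"
    unfolding orbits_level_group[OF D] using finite_orbits by simp
  have nonempty: "?M j \<noteq> {}" if "j \<le> k" for j
    using orbits_nonempty[OF homeo_subgroup_level_group[OF D(1)], of "?M j" k]
      orbits_level_group[OF D, of k] that by blast
  have "inj_on ?M {..k}"
  proof (rule inj_onI)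
    fix i j assume "i \<in> {..k}" "?M i = ?M j"
    then show "i = j" using nonempty[of i] by auto
  qed
  then have "card (?M ` {..k}) = Suc k" by (simp add: card_image)
  moreover have "(orbits H X - {D}) \<inter> ?M ` {..k} = {}"
  proof -
    have "?M j \<notin> orbits H X - {D}" if "j \<le> k" for j
      using nonempty[OF that] orbits_disjoint[OF H _ D(1)] by blast
    then show ?thesis by auto
  qed
  moreover have "card (orbits H X - {D}) + 1 = card (orbits H X)"
    using card_Suc_Diff1[OF finite_orbits D(1)] by simp
  ultimately show "card (orbits (level_group k D) X) = card (orbits H X) + k"
    unfolding orbits_level_group[OF D] using finite_orbits by (subst card_Un_disjoint) auto
qed

text \<open>Level \<open>j\<close> is the difference of two consecutive sets of this kind, which
  makes the pieces of \<open>D\<close> locally closed. For positive \<open>j\<close> the set is a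
  finite union of images of open upper sets on the line.\<close>

lemma openin_level_ge:
  assumes D: "D \<in> orbits H X" "p \<in> C" "pt p s \<in> D"
  shows "openin (top_of_set X) {x \<in> D. j \<le> level k x}"
proof (cases j)
  case 0
  then show ?thesis using orbit_open[OF D(2,1,3)] by simp
next
  case (Suc i)
  let ?Q = "{q \<in> C. cell q \<subseteq> D}"
  have "{x \<in> D. j \<le> level k x} = (\<Union>q\<in>?Q. pt q ` {t. i < lev k t})"
  proof
    show "{x \<in> D. j \<le> level k x} \<subseteq> (\<Union>q\<in>?Q. pt q ` {t. i < lev k t})"
    proof
      fix x assume "x \<in> {x \<in> D. j \<le> level k x}"
      then have x: "x \<in> D" "i < level k x" using Suc by auto
      then obtain q t where q: "q \<in> ?Q" "x = pt q t"
        using orbit_eq_Union_cells[OF D(2,1,3)] by blast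
      then show "x \<in> (\<Union>q\<in>?Q. pt q ` {t. i < lev k t})" using x(2) by auto
    qed
    show "(\<Union>q\<in>?Q. pt q ` {t. i < lev k t}) \<subseteq> {x \<in> D. j \<le> level k x}"
      using Suc pt_in_cell by fastforce
  qed
  moreover have "openin (top_of_set X) (\<Union>q\<in>?Q. pt q ` {t. i < lev k t})"
    by (rule openin_Union) (auto intro!: openin_pt_image open_lev_greater)
  ultimately show ?thesis by simp
qed

lemma height_eq_H:
  assumes "X \<noteq> {}" shows "height H X = enat (card (orbits H X) - 1)"
  by (rule height_eq_card_orbits[OF H closed_X assms orbits_locally_closed finite_orbits])

lemma exists_subgroup_height_add:
  assumes "X \<noteq> {}" "C \<noteq> {}"
  shows "\<exists>G. homeo_subgroup X G \<and> height G X = height H X + enat k"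
proof -
  obtain p where p: "p \<in> C" using assms(2) by blast
  \<comment> \<open>Any cell will do for the splitting, and \<open>0\<close> is just some coordinate
    on it.\<close>
  define D where "D = orbit H (pt p 0)"
  have D: "D \<in> orbits H X" using pt_in[OF p] by (simp add: D_def orbits_def)
  have pD: "pt p 0 \<in> D" unfolding D_def by (rule orbit_self[OF H])
  have DV: "D \<inter> V = {}" by (rule orbit_disjoint_V[OF p D pD])
  let ?G = "level_group k D"
  have G: "homeo_subgroup X ?G" by (rule homeo_subgroup_level_group[OF D])
  have "locally_closed_in X A" if A: "A \<in> orbits ?G X" for A
  proof (cases "A \<in> orbits H X")
    case False
    then obtain j where A_eq: "A = {x \<in> D. level k x = j}"
      using A unfolding orbits_level_group[OF D DV] by auto
    have "A = {x \<in> D. j \<le> level k x} - {x \<in> D. Suc j \<le> level k x}" unfolding A_eq by auto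
    then show ?thesis
      by (rule openin_diff_locally_closed[OF openin_level_ge[OF D p pD] openin_level_ge[OF D p pD]])
  qed (rule orbits_locally_closed)
  then have "height ?G X = enat (card (orbits ?G X) - 1)"
    by (rule height_eq_card_orbits[OF G closed_X assms(1) _ card_orbits_level_group(1)[OF D DV]])
  moreover note height_eq_H[OF assms(1)]
  \<comment> \<open>The subtraction of one is truncated, so positivity is what allows
    \<open>k\<close> to be moved outside it.\<close>
  moreover have "0 < card (orbits H X)" using D finite_orbits by (auto simp: card_gt_0_iff)
  ultimately have "height ?G X = height H X + enat k"
    by (simp add: card_orbits_level_group(2)[OF D DV])
  then show ?thesis using G by blast
qed

end

section \<open>Germs of cells at a vertex\<close>

lemma arc_cell_ends:
  assumes "arc g" shows "pathstart g \<notin> cell g" "pathfinish g \<notin> cell g"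
proof -
  have inj: "inj_on g {0..1}" using assms by (simp add: arc_def)
  have "g t \<noteq> g 0" "g t \<noteq> g 1" if "0 < t" "t < 1" for t
    using inj_onD[OF inj, of t 0] inj_onD[OF inj, of t 1] that by auto
  then show "pathstart g \<notin> cell g" "pathfinish g \<notin> cell g"
    unfolding cell_def pathstart_def pathfinish_def by fastforce+
qed

text \<open>Distinct arcs meet in common ends only, so an interior point of one lies on no other;
  being injective on the closed interval, an arc also keeps its own ends out of its cell.\<close>

lemma topological_graph_cell_structure:
  assumes "topological_graph X"
  obtains V C where "cell_structure X V C" "C \<noteq> {}"
proof -
  obtain F where F: "finite F" "F \<noteq> {}" "\<forall>g\<in>F. arc g" "X = (\<Union>g\<in>F. path_image g)"
    "\<forall>g\<in>F. \<forall>h\<in>F. g \<noteq> h \<longrightarrow> path_image g \<inter> path_image h \<subseteq>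
       {pathstart g, pathfinish g} \<inter> {pathstart h, pathfinish h}"
    using assms unfolding topological_graph_def by (elim conjE exE) (rule that)
  have sep: "x \<notin> path_image h" if "g \<in> F" "h \<in> F" "g \<noteq> h" "x \<in> cell g" for g h x
  proof
    assume "x \<in> path_image h"
    then have "x \<in> {pathstart g, pathfinish g}"
      using F(5) that cell_subset_path_image[of g] by blast
    then show False using arc_cell_ends[of g] F(3) that by auto
  qed
  have "cell_structure X (pathstart ` F \<union> pathfinish ` F) F"
  proof
    fix g assume g: "g \<in> F"
    have arc: "arc g" using F(3) g by simp
    then show "path g" by (rule arc_imp_path)
    have "inj_on g {0..1}" using arc by (simp add: arc_def)
    then show "inj_on g {0<..<1}" by (rule inj_on_subset) auto
    have "x \<notin> pathstart ` F \<union> pathfinish ` F" if x: "x \<in> cell g" for x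
    proof
      assume "x \<in> pathstart ` F \<union> pathfinish ` F"
      then obtain h where h: "h \<in> F" "x = pathstart h \<or> x = pathfinish h" by auto
      show False
      proof (cases "g = h")
        case True
        then show False using arc_cell_ends[OF arc] h(2) x by auto
      next
        case False
        then have "x \<notin> path_image h" by (rule sep[OF g h(1) _ x])
        then show False using h(2) by auto
      qed
    qed
    then show "cell g \<inter> (pathstart ` F \<union> pathfinish ` F) = {}" by blast
    show "g = h" if "h \<in> F" "x \<in> cell g" "x \<in> cell h" for h x
      using sep[OF g that(1) _ that(2)] that(3) cell_subset_path_image[of h] by blast
  qed (use F(1,4) in auto)
  then show thesis using F(2) by (rule that)
qed

lemma cell_reversepath [simp]: "cell (reversepath p) = cell p"
proof -
  have "(\<lambda>t. 1 - t) ` {0<..<1} = {0<..<1::real}"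
  proof
    show "{0<..<1::real} \<subseteq> (\<lambda>t. 1 - t) ` {0<..<1}"
      by (rule subsetI, rule_tac x = "1 - x" in image_eqI) auto
  qed auto
  then show ?thesis unfolding cell_def reversepath_def by (metis image_image)
qed

text \<open>The parameter \<open>b\<close> is monotone and bounded; its limit at \<open>0\<close> is not interior because \<open>\<psi> 0\<close> is
  not in the cell.\<close>

lemma initial_segment:
  fixes q :: "real \<Rightarrow> 'a::metric_space" and b :: "real \<Rightarrow> real"
  assumes q: "path q" "\<psi> 0 \<notin> cell q" and \<psi>: "continuous_on UNIV \<psi>" and \<epsilon>: "0 < \<epsilon>"
    and b: "continuous_on {0<..<\<epsilon>} b" "strict_mono_on {0<..<\<epsilon>} b"
    and b01: "\<And>t. 0 < t \<Longrightarrow> t < \<epsilon> \<Longrightarrow> 0 < b t \<and> b t < 1"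
    and qb: "\<And>t. 0 < t \<Longrightarrow> t < \<epsilon> \<Longrightarrow> q (b t) = \<psi> t"
  shows "pathstart q = \<psi> 0 \<and> (\<exists>\<eta> \<delta>. 0 < \<eta> \<and> 0 < \<delta> \<and> \<delta> < 1 \<and> \<psi> ` {0<..<\<eta>} = q ` {0<..<\<delta>})"
proof -
  \<comment> \<open>The \<open>2\<close> in the denominator keeps every term strictly below
    \<open>\<epsilon>\<close>, including the one at \<open>n = 0\<close>.\<close>
  define u where "u = (\<lambda>n. \<epsilon> / (real n + 2))"
  have u: "0 < u n" "u n < \<epsilon>" for n
  proof -
    show "0 < u n" using \<epsilon> by (simp add: u_def)
    have "\<epsilon> * 1 < \<epsilon> * (real n + 2)" using \<epsilon> by (intro mult_strict_left_mono) auto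
    then show "u n < \<epsilon>" by (simp add: u_def divide_less_eq)
  qed
  have less: "b s < b t" if "0 < s" "s < t" "t < \<epsilon>" for s t
    using b(2) that by (simp add: monotone_on_def)
  have "b (u (Suc n)) \<le> b (u n)" for n
  proof -
    have "u (Suc n) < u n" using \<epsilon> unfolding u_def by (intro divide_strict_left_mono) auto
    then show ?thesis using less u less_imp_le by blast
  qed
  then have dec: "decseq (\<lambda>n. b (u n))" by (rule decseq_SucI)
  moreover have nonneg: "\<forall>n. 0 \<le> b (u n)" using b01[OF u] by (simp add: less_imp_le)
  ultimately obtain L where L: "(\<lambda>n. b (u n)) \<longlonglongrightarrow> L" "\<forall>n. L \<le> b (u n)"
    by (rule decseq_convergent)
  have L01: "0 \<le> L" "L < 1"
  proof -
    show "0 \<le> L" using nonneg by (intro LIMSEQ_le_const[OF L(1)]) simp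
    show "L < 1" using L(2)[rule_format, of 0] b01[OF u, of 0] by linarith
  qed
  have "u \<longlonglongrightarrow> 0"
  proof -
    have "(\<lambda>n. \<epsilon> / real (n + 2)) \<longlonglongrightarrow> 0"
      by (rule LIMSEQ_ignore_initial_segment[OF lim_const_over_n])
    then show ?thesis by (simp add: u_def add.commute)
  qed
  then have "(\<lambda>n. \<psi> (u n)) \<longlonglongrightarrow> \<psi> 0"
    using \<psi> by (intro continuous_on_tendsto_compose[of UNIV \<psi>]) auto
  moreover have "(\<lambda>n. q (b (u n))) \<longlonglongrightarrow> q L"
  proof (rule continuous_on_tendsto_compose[OF _ L(1)])
    show "continuous_on {0..1} q" using q(1) by (simp add: path_def)
    show "L \<in> {0..1}" using L01 by simp
    show "\<forall>\<^sub>F n in sequentially. b (u n) \<in> {0..1}"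
      using b01[OF u] by (intro always_eventually allI) (simp add: less_imp_le)
  qed
  ultimately have qL: "q L = \<psi> 0" using qb[OF u] by (simp add: LIMSEQ_unique)
  have "q L \<in> cell q" if "0 < L" using that L01(2) unfolding cell_def by simp
  then have "L = 0" using q(2) L01(1) qL by (cases "0 < L") simp_all
  then have start: "pathstart q = \<psi> 0" using qL by (simp add: pathstart_def)
  \<comment> \<open>Stopping halfway keeps the right end inside the range of the hypotheses on
    \<open>b\<close>; the value of \<open>b\<close> there is the \<open>\<delta>\<close> of the
    conclusion.\<close>
  define \<eta> where "\<eta> = \<epsilon> / 2"
  have \<eta>: "0 < \<eta>" "\<eta> < \<epsilon>" using \<epsilon> by (auto simp: \<eta>_def)
  have "b ` {0<..<\<eta>} = {0<..<b \<eta>}"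
  proof
    show "b ` {0<..<\<eta>} \<subseteq> {0<..<b \<eta>}" using less b01 \<eta> by auto
    show "{0<..<b \<eta>} \<subseteq> b ` {0<..<\<eta>}"
    proof
      fix y assume y: "y \<in> {0<..<b \<eta>}"
      then have "\<forall>\<^sub>F n in sequentially. b (u n) < y"
        using L(1) \<open>L = 0\<close> by (intro order_tendstoD(2)) auto
      then obtain n where n: "b (u n) < y" by (auto simp: eventually_sequentially)
      then have "b (u n) < b \<eta>" using y by auto
      then have un: "u n < \<eta>" using less[of \<eta> "u n"] \<eta>(1) u(2)[of n] by (cases "u n" \<eta> rule: linorder_cases) auto
      have "continuous_on {u n..\<eta>} b"
        by (rule continuous_on_subset[OF b(1)]) (use u(1)[of n] \<eta> in auto)
      then obtain t where t: "u n \<le> t" "t \<le> \<eta>" "b t = y"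
        using IVT'[of b "u n" y \<eta>] n y un by auto
      then have "t \<noteq> \<eta>" using y by auto
      then show "y \<in> b ` {0<..<\<eta>}" using t u(1)[of n] by (intro image_eqI[of _ _ t]) auto
    qed
  qed
  moreover have "\<psi> ` {0<..<\<eta>} = q ` b ` {0<..<\<eta>}"
    unfolding image_image using qb \<eta>(2) by (intro image_cong) auto
  ultimately have "\<psi> ` {0<..<\<eta>} = q ` {0<..<b \<eta>}" by simp
  then show ?thesis using start b01[OF \<eta>] \<eta>(1) by blast
qed

context cell_structure
begin

text \<open>An oriented cell starting at a vertex stands for a germ of the graph there, so a loop
  contributes two germs to its vertex.\<close>

definition oriented :: "(real \<Rightarrow> 'a) set" where
  "oriented = C \<union> reversepath ` C"

lemma orientedE:
  assumes "q \<in> oriented"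
  obtains p where "p \<in> C" "q = p \<or> q = reversepath p"
  using assms that by (auto simp: oriented_def)

lemma oriented_props:
  assumes q: "q \<in> oriented"
  shows "path q" "inj_on q {0<..<1}" "pathstart q \<in> V" "pathfinish q \<in> V" "cell q \<inter> V = {}"
    "path_image q \<subseteq> X" "openin (top_of_set X) (cell q)"
proof -
  obtain p where p: "p \<in> C" "q = p \<or> q = reversepath p" using q by (rule orientedE)
  have "inj_on (reversepath p) {0<..<1}"
  proof (rule inj_onI)
    fix s t assume st: "s \<in> {0<..<1::real}" "t \<in> {0<..<1}" "reversepath p s = reversepath p t"
    then have "1 - s = 1 - t" by (intro inj_onD[OF inj[OF p(1)]]) (auto simp: reversepath_def)
    then show "s = t" by simp
  qed
  then show "inj_on q {0<..<1}" using p(2) inj[OF p(1)] by auto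
  show "path q" "pathstart q \<in> V" "pathfinish q \<in> V" "cell q \<inter> V = {}"
    "path_image q \<subseteq> X" "openin (top_of_set X) (cell q)"
    using p(2) path[OF p(1)] ends[OF p(1)] cell_V[OF p(1)] path_image_subset[OF p(1)] openin_cell[OF p(1)]
    by auto
qed

text \<open>Since \<open>\<psi>\<close> is injective and \<open>V\<close> finite, the curve avoids
  the vertices for small positive times and stays in one cell. There its path parameter is
  continuous and injective, hence monotone, and the direction decides which orientation of the cell
  starts at \<open>\<psi> 0\<close>.\<close>

lemma germ:
  fixes \<psi> :: "real \<Rightarrow> 'a"
  assumes \<psi>: "continuous_on UNIV \<psi>" "inj \<psi>" "range \<psi> \<subseteq> X" and v: "\<psi> 0 \<in> V"
  shows "\<exists>q \<eta> \<delta>. q \<in> oriented \<and> pathstart q = \<psi> 0 \<and> 0 < \<eta> \<and> 0 < \<delta> \<and> \<delta> < 1 \<and>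
    \<psi> ` {0<..<\<eta>} = q ` {0<..<\<delta>}"
proof -
  have "finite (\<psi> -` V)" using finite_V \<psi>(2) by (rule finite_vimageI)
  then obtain \<epsilon> where \<epsilon>: "0 < \<epsilon>" "\<forall>t\<in>\<psi> -` V. t \<noteq> 0 \<longrightarrow> \<epsilon> \<le> dist 0 t"
    using finite_set_avoid by blast
  have out: "\<psi> t \<in> X - V" if "0 < t" "t < \<epsilon>" for t
  proof -
    have "t \<notin> \<psi> -` V"
    proof
      assume "t \<in> \<psi> -` V"
      then have "\<epsilon> \<le> dist 0 t" using \<epsilon>(2)[rule_format, of t] that by simp
      then show False using that by (simp add: dist_real_def)
    qed
    then show ?thesis using \<psi>(3) by auto
  qed
  have "\<psi> (\<epsilon> / 2) \<in> X" "\<psi> (\<epsilon> / 2) \<notin> V" using out[of "\<epsilon> / 2"] \<epsilon>(1) by auto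
  then obtain p s where p: "p \<in> C" "\<psi> (\<epsilon> / 2) = pt p s" by (rule cellE)
  have "\<psi> ` {0<..<\<epsilon>} \<subseteq> cell p"
  proof (rule connected_in_cell[OF _ _ p(1)])
    show "connected (\<psi> ` {0<..<\<epsilon>})"
      using continuous_on_subset[OF \<psi>(1)] by (intro connected_continuous_image) auto
    show "\<psi> ` {0<..<\<epsilon>} \<subseteq> X - V" using out by auto
    show "pt p s \<in> \<psi> ` {0<..<\<epsilon>}" using p(2)[symmetric] \<epsilon>(1) by simp
  qed simp
  then have in_cell: "\<psi> t \<in> cell p" if "0 < t" "t < \<epsilon>" for t using that by auto
  define b where "b = (\<lambda>t. logistic (coord (\<psi> t)))"
  have pb: "p (b t) = \<psi> t" if "0 < t" "t < \<epsilon>" for t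
  proof -
    have "\<psi> t \<in> cell p" using that by (rule in_cell)
    then obtain s where "\<psi> t = pt p s" unfolding range_pt[symmetric] by (rule rangeE)
    then show ?thesis using p(1) by (simp add: b_def pt_def[symmetric])
  qed
  have b01: "0 < b t" "b t < 1" for t by (simp_all add: b_def logistic_bounds)
  have cont: "continuous_on {0<..<\<epsilon>} b"
    unfolding b_def
  proof (rule continuous_on_compose2[OF continuous_on_logistic[of UNIV]])
    show "continuous_on {0<..<\<epsilon>} (\<lambda>t. coord (\<psi> t))"
      using in_cell continuous_on_subset[OF \<psi>(1)]
      by (intro continuous_on_compose2[OF continuous_on_coord[OF p(1)]]) auto
  qed simp
  have "inj_on b {0<..<\<epsilon>}"
  proof (rule inj_onI)
    fix s t assume "s \<in> {0<..<\<epsilon>}" "t \<in> {0<..<\<epsilon>}" "b s = b t"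
    then have "\<psi> s = \<psi> t" using pb[of s] pb[of t] by simp
    then show "s = t" using \<psi>(2) by (rule injD[rotated])
  qed
  then have "strict_mono_on {0<..<\<epsilon>} b \<or> strict_antimono_on {0<..<\<epsilon>} b"
    using injective_eq_monotone_map[OF _ cont] is_interval_oo by blast
  then show ?thesis
  proof
    assume mono: "strict_mono_on {0<..<\<epsilon>} b"
    have "\<psi> 0 \<notin> cell p" using v cell_V[OF p(1)] by blast
    from initial_segment[OF path[OF p(1)] this \<psi>(1) \<epsilon>(1) cont mono _ pb]
    have "pathstart p = \<psi> 0 \<and> (\<exists>\<eta> \<delta>. 0 < \<eta> \<and> 0 < \<delta> \<and> \<delta> < 1 \<and> \<psi> ` {0<..<\<eta>} = p ` {0<..<\<delta>})"
      by (simp add: b01)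
    then show ?thesis using p(1) by (intro exI[of _ p]) (auto simp: oriented_def)
  next
    assume anti: "strict_antimono_on {0<..<\<epsilon>} b"
    let ?q = "reversepath p"
    have "\<psi> 0 \<notin> cell ?q" "path ?q" using v cell_V[OF p(1)] path[OF p(1)] by auto
    moreover have "continuous_on {0<..<\<epsilon>} (\<lambda>t. 1 - b t)" using cont by (intro continuous_intros)
    moreover have "strict_mono_on {0<..<\<epsilon>} (\<lambda>t. 1 - b t)" using anti by (simp add: monotone_on_def)
    moreover have "?q (1 - b t) = \<psi> t" if "0 < t" "t < \<epsilon>" for t
      using pb[OF that] by (simp add: reversepath_def)
    ultimately have "pathstart ?q = \<psi> 0 \<and> (\<exists>\<eta> \<delta>. 0 < \<eta> \<and> 0 < \<delta> \<and> \<delta> < 1 \<and> \<psi> ` {0<..<\<eta>} = ?q ` {0<..<\<delta>})"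
      using \<psi>(1) \<epsilon>(1) b01 by (intro initial_segment[where b = "\<lambda>t. 1 - b t"]) auto
    then show ?thesis using p(1) by (intro exI[of _ ?q]) (auto simp: oriented_def)
  qed
qed

end

section \<open>Removing a vertex\<close>

lemma image_half_interval:
  "(\<lambda>t::real. 1 - 2 * t) ` {0<..<1/2} = {0<..<1}" "(\<lambda>t::real. 2 * t - 1) ` {1/2<..<1} = {0<..<1}"
proof -
  show "(\<lambda>t::real. 1 - 2 * t) ` {0<..<1/2} = {0<..<1}"
  proof
    show "{0<..<1} \<subseteq> (\<lambda>t::real. 1 - 2 * t) ` {0<..<1/2}"
      by (rule subsetI, rule_tac x = "(1 - x) / 2" in image_eqI) (auto simp: field_simps)
  qed auto
  show "(\<lambda>t::real. 2 * t - 1) ` {1/2<..<1} = {0<..<1}"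
  proof
    show "{0<..<1} \<subseteq> (\<lambda>t::real. 2 * t - 1) ` {1/2<..<1}"
      by (rule subsetI, rule_tac x = "(1 + x) / 2" in image_eqI) (auto simp: field_simps)
  qed auto
qed

lemma join_cells:
  assumes "pathstart a = v" "pathstart b = v" "inj_on a {0<..<1}" "inj_on b {0<..<1}"
    "v \<notin> cell a" "v \<notin> cell b" "cell a \<inter> cell b = {}"
  defines "c \<equiv> reversepath a +++ b"
  shows "cell c = insert v (cell a \<union> cell b)" "inj_on c {0<..<1}"
proof -
  have left: "c t = a (1 - 2 * t)" if "t < 1/2" for t
    using that by (simp add: c_def joinpaths_def reversepath_def)
  have right: "c t = b (2 * t - 1)" if "1/2 < t" for t
    using that by (simp add: c_def joinpaths_def)
  have mid: "c (1/2) = v"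
    using assms(1) by (simp add: c_def joinpaths_def reversepath_def pathstart_def)
  have split: "{0<..<1::real} = insert (1/2) ({0<..<1/2} \<union> {1/2<..<1})" by auto
  have "c ` {0<..<1/2} = (\<lambda>t. a (1 - 2 * t)) ` {0<..<1/2}" using left by (intro image_cong) auto
  also have "\<dots> = cell a" unfolding cell_def image_half_interval(1)[symmetric] by (simp add: image_image)
  finally have L: "c ` {0<..<1/2} = cell a" .
  have "c ` {1/2<..<1} = (\<lambda>t. b (2 * t - 1)) ` {1/2<..<1}" using right by (intro image_cong) auto
  also have "\<dots> = cell b" unfolding cell_def image_half_interval(2)[symmetric] by (simp add: image_image)
  finally have R: "c ` {1/2<..<1} = cell b" .
  show "cell c = insert v (cell a \<union> cell b)"
    unfolding cell_def[of c] split image_insert image_Un L R mid ..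
  have "inj_on c {0<..<1/2}"
  proof (rule inj_onI)
    fix s t assume st: "s \<in> {0<..<1/2::real}" "t \<in> {0<..<1/2}" "c s = c t"
    then have "1 - 2 * s = 1 - 2 * t" by (intro inj_onD[OF assms(3)]) (auto simp: left)
    then show "s = t" by simp
  qed
  moreover have "inj_on c {1/2<..<1}"
  proof (rule inj_onI)
    fix s t assume st: "s \<in> {1/2<..<1::real}" "t \<in> {1/2<..<1}" "c s = c t"
    then have "2 * s - 1 = 2 * t - 1" by (intro inj_onD[OF assms(4)]) (auto simp: right)
    then show "s = t" by simp
  qed
  moreover have "{0<..<1/2::real} - {1/2<..<1} = {0<..<1/2}" "{1/2<..<1::real} - {0<..<1/2} = {1/2<..<1}"
    by auto
  ultimately have "inj_on c ({0<..<1/2} \<union> {1/2<..<1})"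
    unfolding inj_on_Un using L R assms(7) by simp
  moreover have "({0<..<1/2::real} \<union> {1/2<..<1}) - {1/2} = {0<..<1/2} \<union> {1/2<..<1}" by auto
  ultimately show "inj_on c {0<..<1}"
    unfolding split inj_on_insert using assms(5,6) by (simp add: image_Un L R mid)
qed

context cell_structure
begin

lemma oriented_same_cell:
  assumes a: "a \<in> oriented" and b: "b \<in> oriented" and x: "x \<in> cell a" "x \<in> cell b"
  shows "b = a \<or> b = reversepath a"
proof -
  obtain p where p: "p \<in> C" "a = p \<or> a = reversepath p" using a by (rule orientedE)
  obtain q where q: "q \<in> C" "b = q \<or> b = reversepath q" using b by (rule orientedE)
  have "x \<in> cell p" "x \<in> cell q" using x p(2) q(2) by auto
  then have "p = q" by (rule cells_disjoint[OF p(1) q(1)])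
  then show ?thesis using p(2) q(2) by auto
qed

lemma cell_nonempty: "cell a \<noteq> {}"
  using pt_in_cell by blast

text \<open>A common point forces \<open>r\<close> to be \<open>a\<close> or its reverse. The bound
  \<open>t < 1 - \<delta>\<close> excludes the reverse, which at time \<open>t\<close> is still
  beyond parameter \<open>\<delta>\<close> of \<open>a\<close>.\<close>

lemma in_initial_segment:
  assumes a: "a \<in> oriented" and r: "r \<in> oriented" and "0 < t" "t < 1 - \<delta>" "\<delta> < 1" "r t \<in> a ` {0<..<\<delta>}" "t < 1"
  shows "r = a"
proof -
  obtain s where s: "0 < s" "s < \<delta>" "r t = a s" using assms(6) by auto
  have "a s \<in> cell a" using s(1,2) assms(5) by (simp add: cell_def)
  moreover have "a s \<in> cell r" using assms(3,7) unfolding s(3)[symmetric] by (simp add: cell_def)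
  ultimately consider "r = a" | "r = reversepath a" using oriented_same_cell[OF a r] by blast
  then show "r = a"
  proof cases
    case 2
    then have "a (1 - t) = a s" using s(3) by (simp add: reversepath_def)
    then have "1 - t = s" by (rule inj_onD[OF oriented_props(2)[OF a]]) (use assms s in auto)
    then show ?thesis using assms(4) s(2) by simp
  qed
qed

text \<open>Near \<open>v\<close> the set \<open>U\<close> holds nothing but initial segments of
  \<open>a\<close> and \<open>b\<close>, so a path leaving \<open>v\<close> must begin along one of
  them.\<close>

lemma only_two_germs:
  assumes a: "a \<in> oriented" and b: "b \<in> oriented" and r: "r \<in> oriented" and v: "pathstart r = v"
    and \<delta>: "\<delta>\<^sub>1 < 1" "\<delta>\<^sub>2 < 1"
    and U: "openin (top_of_set X) U" "v \<in> U" "U \<subseteq> insert v (a ` {0<..<\<delta>\<^sub>1} \<union> b ` {0<..<\<delta>\<^sub>2})"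
  shows "r = a \<or> r = b"
proof -
  note pr = oriented_props[OF r]
  have "continuous_on {0..1} r" using pr(1) by (simp add: path_def)
  moreover have "r ` {0..1} \<subseteq> X" using pr(6) by (simp add: path_image_def)
  then have "r \<in> {0..1} \<rightarrow> X" by auto
  ultimately have "openin (top_of_set {0..1}) ({0..1} \<inter> r -` U)"
    using U(1) by (rule continuous_openin_preimage)
  then obtain T where T: "open T" "{0..1} \<inter> r -` U = {0..1} \<inter> T" by (auto simp: openin_open)
  have "0 \<in> {0..1} \<inter> r -` U" using U(2) v by (simp add: pathstart_def)
  then have "0 \<in> T" unfolding T(2) by simp
  then obtain e where e: "0 < e" "ball 0 e \<subseteq> T" using T(1) by (auto simp: open_contains_ball)
  \<comment> \<open>Small enough for \<open>r\<close> to be still in \<open>U\<close>, and below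
    \<open>1 - \<delta>\<^sub>1\<close> and \<open>1 - \<delta>\<^sub>2\<close> so that a reversed
    cell is not mistaken for an initial segment.\<close>
  define t where "t = Min {e, 1, 1 - \<delta>\<^sub>1, 1 - \<delta>\<^sub>2} / 2"
  have m: "0 < Min {e, 1, 1 - \<delta>\<^sub>1, 1 - \<delta>\<^sub>2}" using e(1) \<delta> by simp
  then have t: "0 < t" by (simp add: t_def)
  have "t < Min {e, 1, 1 - \<delta>\<^sub>1, 1 - \<delta>\<^sub>2}" using m unfolding t_def by linarith
  then have t': "t < e" "t < 1" "t < 1 - \<delta>\<^sub>1" "t < 1 - \<delta>\<^sub>2" by simp_all
  have "t \<in> ball 0 e" using t t'(1) by (simp add: dist_real_def)
  then have "t \<in> {0..1} \<inter> T" using e(2) t t'(2) by auto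
  then have "r t \<in> U" unfolding T(2)[symmetric] by simp
  moreover have "v \<notin> cell r" using pr(3,5) unfolding v by blast
  then have "r t \<noteq> v" using t t'(2) by (auto simp: cell_def)
  ultimately have "r t \<in> a ` {0<..<\<delta>\<^sub>1} \<or> r t \<in> b ` {0<..<\<delta>\<^sub>2}" using U(3) by blast
  then show ?thesis
    using in_initial_segment[OF a r t t'(3) \<delta>(1) _ t'(2)] in_initial_segment[OF b r t t'(4) \<delta>(2) _ t'(2)]
    by blast
qed

lemma reversepath_oriented: "a \<in> oriented \<Longrightarrow> reversepath a \<in> oriented"
  by (elim orientedE) (auto simp: oriented_def)

lemma reversepath_ne:
  assumes "a \<in> oriented" shows "reversepath a \<noteq> a"
proof
  assume "reversepath a = a"
  then have "reversepath a (1/4) = a (1/4)" by simp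
  then have "a (3/4) = a (1/4)" by (simp add: reversepath_def)
  then have "3/4 = (1/4::real)" by (rule inj_onD[OF oriented_props(2)[OF assms]]) auto
  then show False by simp
qed

text \<open>The two cells are joined through \<open>v\<close> into one, which is a loop if they
  share their other end. No further cell may end at \<open>v\<close>, or erasing \<open>v\<close>
  would take away its end.\<close>

lemma merge_cells:
  assumes a: "a \<in> oriented" and b: "b \<in> oriented" and v: "pathstart a = v" "pathstart b = v"
    and ab: "cell a \<inter> cell b = {}" and germs: "\<And>r. r \<in> oriented \<Longrightarrow> pathstart r = v \<Longrightarrow> r = a \<or> r = b"
  shows "\<exists>C'. cell_structure X (V - {v}) C'"
proof -
  \<comment> \<open>If \<open>a\<close> returned to \<open>v\<close>, its reverse would be a germ at
    \<open>v\<close> other than \<open>a\<close>, hence equal to \<open>b\<close>, against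
    disjointness of the two cells; likewise for \<open>b\<close>.\<close>
  have ends_ne: "pathfinish a \<noteq> v" "pathfinish b \<noteq> v"
  proof -
    show "pathfinish a \<noteq> v"
    proof
      assume "pathfinish a = v"
      then have "reversepath a = a \<or> reversepath a = b" using germs[OF reversepath_oriented[OF a]] by simp
      then have "cell a = cell b" using reversepath_ne[OF a] cell_reversepath by metis
      then show False using ab cell_nonempty[of a] by simp
    qed
    show "pathfinish b \<noteq> v"
    proof
      assume "pathfinish b = v"
      then have "reversepath b = a \<or> reversepath b = b" using germs[OF reversepath_oriented[OF b]] by simp
      then have "cell a = cell b" using reversepath_ne[OF b] cell_reversepath by metis
      then show False using ab cell_nonempty[of a] by simp
    qed
  qed
  obtain p where p: "p \<in> C" "a = p \<or> a = reversepath p" using a by (rule orientedE)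
  obtain q where q: "q \<in> C" "b = q \<or> b = reversepath q" using b by (rule orientedE)
  define c where "c = reversepath a +++ b"
  note pa = oriented_props[OF a] and pb = oriented_props[OF b]
  have vV: "v \<in> V" using pa(3) v(1) by simp
  have notin: "v \<notin> cell r" if "r \<in> oriented" for r
    using oriented_props(5)[OF that] vV by blast
  have cell_c: "cell c = insert v (cell a \<union> cell b)" and inj_c: "inj_on c {0<..<1}"
    unfolding c_def using join_cells[OF v pa(2) pb(2) notin[OF a] notin[OF b] ab] by simp_all
  have cell_ab: "cell a = cell p" "cell b = cell q" "path_image a = path_image p" "path_image b = path_image q"
    using p(2) q(2) by auto
  have fin_c: "pathfinish (reversepath a) = pathstart b" using v by simp
  have im_c: "path_image c = path_image p \<union> path_image q"
    unfolding c_def path_image_join[OF fin_c] path_image_reversepath cell_ab ..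
  define C' where "C' = insert c (C - {p, q})"
  \<comment> \<open>Applying \<open>germs\<close> to a cell and to its reverse takes care of both
    ends.\<close>
  have old: "v \<noteq> pathstart r \<and> v \<noteq> pathfinish r" if r: "r \<in> C - {p, q}" for r
  proof -
    have "cell r \<noteq> cell a" "cell r \<noteq> cell b"
      using r cells_disjoint[of r p "pt r 0"] cells_disjoint[of r q "pt r 0"] p(1) q(1)
      unfolding cell_ab by force+
    then have "r \<noteq> a" "r \<noteq> b" "reversepath r \<noteq> a" "reversepath r \<noteq> b"
      using cell_reversepath[of r] by auto
    moreover have "r \<in> oriented" "reversepath r \<in> oriented" using r by (auto simp: oriented_def)
    ultimately show ?thesis using germs[of r] germs[of "reversepath r"] by auto
  qed
  have "cell_structure X (V - {v}) C'"
  proof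
    show "finite (V - {v})" "finite C'" "V - {v} \<subseteq> X"
      using finite_V finite_C V_subset by (auto simp: C'_def)
    show "X = (\<Union>r\<in>C'. path_image r)"
      using p(1) q(1) unfolding X_eq C'_def by (auto simp: im_c)
    fix r assume "r \<in> C'"
    then consider "r = c" | "r \<in> C - {p, q}" unfolding C'_def by blast
    then have props: "path r \<and> inj_on r {0<..<1} \<and> pathstart r \<in> V - {v} \<and> pathfinish r \<in> V - {v} \<and>
      cell r \<inter> (V - {v}) = {}"
    proof cases
      case 1
      have "path c" unfolding c_def using pa(1) pb(1) fin_c by simp
      moreover have "pathstart c = pathfinish a" "pathfinish c = pathfinish b" by (simp_all add: c_def)
      moreover have "cell c \<inter> (V - {v}) = {}" unfolding cell_c using pa(5) pb(5) by blast
      ultimately show ?thesis using 1 inj_c pa(4) pb(4) ends_ne by simp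
    next
      case 2
      then have r: "r \<in> C" by simp
      have "cell r \<inter> (V - {v}) = {}" using cell_V[OF r] by blast
      then show ?thesis using path[OF r] inj[OF r] ends[OF r] old[OF 2] by auto
    qed
    then show "path r" "inj_on r {0<..<1}" "pathstart r \<in> V - {v}" "pathfinish r \<in> V - {v}"
      "cell r \<inter> (V - {v}) = {}" by blast+
    fix s x assume s: "s \<in> C'" "x \<in> cell r" "x \<in> cell s"
    have sep: "x \<notin> cell c" if t: "t \<in> C - {p, q}" and x: "x \<in> cell t" for t x
    proof -
      have "x \<notin> cell p" "x \<notin> cell q" using cells_disjoint[OF _ p(1) x] cells_disjoint[OF _ q(1) x] t by auto
      moreover have "x \<noteq> v" using cell_V[of t] t vV x by blast
      ultimately show ?thesis unfolding cell_c cell_ab by simp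
    qed
    show "r = s"
      using \<open>r \<in> C'\<close> s sep cells_disjoint[of r s x] unfolding C'_def by auto
  qed
  then show ?thesis by (rule exI)
qed

text \<open>The loop is compact, and \<open>U\<close> makes it open around \<open>v\<close> as well;
  connectedness leaves nothing else in \<open>X\<close>, which is thus a circle.\<close>

lemma loop_structure:
  assumes conn: "connected X" and a: "a \<in> oriented" "pathstart a = v" "pathfinish a = v"
    and U: "openin (top_of_set X) U" "v \<in> U" "U \<subseteq> path_image a"
  shows "cell_structure X {v} {a}"
proof -
  note pa = oriented_props[OF a(1)]
  have im: "path_image a = insert v (cell a)" using a(2,3) by (simp add: path_image_cell)
  then have "path_image a = U \<union> cell a" using U(2,3) by auto
  then have "openin (top_of_set X) (path_image a)" using U(1) pa(7) by (simp add: openin_Un)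
  moreover have "closedin (top_of_set X) (path_image a)"
    using pa(1,6) by (intro closed_subset closed_path_image)
  ultimately have X: "X = path_image a" using conn by (auto simp: connected_clopen)
  show ?thesis
  proof
    show "{v} \<subseteq> X" unfolding X im by simp
    show "cell p \<inter> {v} = {}" if "p \<in> {a}" for p using that pa(3,5) a(2) by auto
  qed (use X a pa in auto)
qed

text \<open>Near \<open>f v\<close> the graph is an open arc, and the inverse of \<open>f\<close>
  pulls it back to an arc that is a neighbourhood of \<open>v\<close>. Its halves are the only germs
  at \<open>v\<close>: if they lie in different cells these merge, and if they are the two ends of
  one cell the graph is a circle.\<close>

lemma remove_vertex:
  assumes conn: "connected X" and f: "f \<in> Homeo X" and v: "v \<in> V" "f v \<notin> V"
  shows "(\<exists>C'. cell_structure X (V - {v}) C') \<or> (\<exists>p. cell_structure X {v} {p})"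
proof -
  obtain g where g: "g \<in> Homeo X" "homeomorphism X X f g" "\<forall>x. f (g x) = x" "\<forall>x. g (f x) = x"
    using f by (rule Homeo_inverse)
  have "f v \<in> X" using v(1) V_subset Homeo_in[OF f] by auto
  then obtain p s where p: "p \<in> C" "f v = pt p s" using v(2) by (rule cellE)
  define \<psi> where "\<psi> = (\<lambda>t. g (pt p (s + t)))"
  define \<phi> where "\<phi> = (\<lambda>t. \<psi> (- t))"
  have \<psi>0: "\<psi> 0 = v" "\<phi> 0 = v" using p(2)[symmetric] g(4) by (simp_all add: \<psi>_def \<phi>_def)
  have cont: "continuous_on UNIV \<psi>"
  proof -
    have "continuous_on UNIV (\<lambda>t. pt p (s + t))"
      by (rule continuous_on_compose2[OF continuous_on_pt[OF p(1), of UNIV]]) (auto intro!: continuous_intros)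
    moreover have "(\<lambda>t. pt p (s + t)) ` UNIV \<subseteq> X" using pt_in[OF p(1)] by auto
    ultimately show ?thesis unfolding \<psi>_def
      by (intro continuous_on_compose2[OF Homeo_continuous[OF g(1)]])
  qed
  then have cont': "continuous_on UNIV \<phi>" unfolding \<phi>_def
    by (rule continuous_on_compose2) (auto intro!: continuous_intros)
  have inj: "inj \<psi>"
  proof (rule injI)
    fix x y assume "\<psi> x = \<psi> y"
    then have "pt p (s + x) = pt p (s + y)" unfolding \<psi>_def by (rule injD[OF Homeo_inj[OF g(1)]])
    then show "x = y" using p(1) by (simp add: pt_eq_iff)
  qed
  have inj': "inj \<phi>"
  proof (rule injI)
    fix x y assume "\<phi> x = \<phi> y"
    then have "- x = - y" unfolding \<phi>_def by (rule injD[OF inj])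
    then show "x = y" by simp
  qed
  have ran: "range \<psi> \<subseteq> X" "range \<phi> \<subseteq> X"
    using pt_in[OF p(1)] Homeo_in[OF g(1)] by (auto simp: \<psi>_def \<phi>_def)
  obtain a \<eta>\<^sub>1 \<delta>\<^sub>1 where a: "a \<in> oriented" "pathstart a = v" "0 < \<eta>\<^sub>1" "0 < \<delta>\<^sub>1" "\<delta>\<^sub>1 < 1"
    "\<psi> ` {0<..<\<eta>\<^sub>1} = a ` {0<..<\<delta>\<^sub>1}"
    using germ[OF cont inj ran(1)] v(1) unfolding \<psi>0 by auto
  obtain b \<eta>\<^sub>2 \<delta>\<^sub>2 where b: "b \<in> oriented" "pathstart b = v" "0 < \<eta>\<^sub>2" "0 < \<delta>\<^sub>2" "\<delta>\<^sub>2 < 1"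
    "\<phi> ` {0<..<\<eta>\<^sub>2} = b ` {0<..<\<delta>\<^sub>2}"
    using germ[OF cont' inj' ran(2)] v(1) unfolding \<psi>0 by auto
  \<comment> \<open>The halves of an injective curve are disjoint, while two initial segments of one
    oriented cell would overlap.\<close>
  have "a ` {0<..<\<delta>\<^sub>1} \<inter> b ` {0<..<\<delta>\<^sub>2} = {}"
    unfolding a(6)[symmetric] b(6)[symmetric] \<phi>_def by (auto dest!: injD[OF inj])
  moreover have "a (min \<delta>\<^sub>1 \<delta>\<^sub>2 / 2) \<in> a ` {0<..<\<delta>\<^sub>1} \<inter> a ` {0<..<\<delta>\<^sub>2}"
    using a(4) b(4) by (intro IntI imageI) (auto simp: min_def)
  ultimately have ne: "a \<noteq> b" by blast
  define U where "U = \<psi> ` {- \<eta>\<^sub>2<..<\<eta>\<^sub>1}"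
  \<comment> \<open>An open interval of the cell around \<open>f v\<close>, moved by the
    homeomorphism \<open>g\<close>, is open in \<open>X\<close>.\<close>
  have "openin (top_of_set X) (g ` (pt p ` ((+) s ` {- \<eta>\<^sub>2<..<\<eta>\<^sub>1})))"
    by (rule homeomorphism_imp_open_map[OF homeomorphism_symD[OF g(2)]])
      (intro openin_pt_image[OF p(1)] open_translation open_greaterThanLessThan)
  then have U: "openin (top_of_set X) U" by (simp add: U_def \<psi>_def image_image)
  have vU: "v \<in> U" unfolding U_def \<psi>0(1)[symmetric] using a(3) b(3) by (intro imageI) simp
  have Usub: "U \<subseteq> insert v (a ` {0<..<\<delta>\<^sub>1} \<union> b ` {0<..<\<delta>\<^sub>2})"
  proof
    fix x assume "x \<in> U"
    then obtain t where t: "- \<eta>\<^sub>2 < t" "t < \<eta>\<^sub>1" "x = \<psi> t" by (auto simp: U_def)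
    consider "t = 0" | "0 < t" | "t < 0" by linarith
    then show "x \<in> insert v (a ` {0<..<\<delta>\<^sub>1} \<union> b ` {0<..<\<delta>\<^sub>2})"
    proof cases
      case 2
      then have "x \<in> \<psi> ` {0<..<\<eta>\<^sub>1}" using t by simp
      then show ?thesis unfolding a(6) by simp
    next
      case 3
      then have "x \<in> \<phi> ` {0<..<\<eta>\<^sub>2}" using t by (intro image_eqI[of _ _ "- t"]) (auto simp: \<phi>_def)
      then show ?thesis unfolding b(6) by simp
    qed (use t \<psi>0 in simp)
  qed
  have germs: "r = a \<or> r = b" if "r \<in> oriented" "pathstart r = v" for r
    by (rule only_two_germs[OF a(1) b(1) that a(5) b(5) U vU Usub])
  show ?thesis
  proof (cases "cell a \<inter> cell b = {}")
    case True
    show ?thesis using merge_cells[OF a(1) b(1) a(2) b(2) True germs] by blast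
  next
    case False
    then have ba: "b = reversepath a" using oriented_same_cell[OF a(1) b(1)] ne by blast
    then have fin: "pathfinish a = v" using b(2) by simp
    have "a ` {0<..<\<delta>\<^sub>1} \<subseteq> cell a" "b ` {0<..<\<delta>\<^sub>2} \<subseteq> cell b"
      using a(5) b(5) by (auto simp: cell_def)
    then have "U \<subseteq> insert v (cell a)" using Usub unfolding ba cell_reversepath by blast
    then have "U \<subseteq> path_image a" unfolding path_image_cell a(2) by blast
    then show ?thesis using loop_structure[OF conn a(1,2) fin U vU] by blast
  qed
qed

end

section \<open>Heights of subgroups\<close>

text \<open>\<open>f\<close> carries the vertex into the cell and translations take it to every
  other cell point, so the full group has one orbit. Fixing \<open>v\<close> yields two orbits and
  height one, and splitting the cell then produces the larger heights.\<close>

lemma loop_heights: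
  assumes X: "cell_structure X {v} {p}" and f: "f \<in> Homeo X" "f v \<noteq> v"
  shows "height (Homeo X) X = 0" "\<exists>G. homeo_subgroup X G \<and> height G X = enat (Suc k)"
proof -
  interpret cell_structure X "{v}" "{p}" by (rule X)
  note HX = homeo_subgroup_Homeo[of X]
  have vX: "v \<in> X" using V_subset by simp
  have X_eq: "X = insert v (cell p)" using X_cells by simp
  have moves: "cell_map (\<lambda>_ x. x + c) \<in> Homeo X" for c
    by (rule cell_map_Homeo) (rule order_aut_translation)
  have transitive: "orbit (Homeo X) v = X"
  proof
    show "orbit (Homeo X) v \<subseteq> X" by (rule orbit_subset[OF HX vX])
    have "f v \<in> X" "f v \<notin> {v}" using f vX by (simp_all add: Homeo_in)
    then obtain q s where "q \<in> {p}" "f v = pt q s" by (rule cellE)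
    then have "f v = pt p s" by simp
    then have s: "pt p s \<in> orbit (Homeo X) v"
      unfolding orbit_def using f(1) by (intro rev_image_eqI[of f]) simp_all
    have "pt p t \<in> orbit (Homeo X) v" for t
      using orbit_apply[OF HX s moves[of "t - s"]] by simp
    then have "cell p \<subseteq> orbit (Homeo X) v" unfolding range_pt[symmetric] by (rule image_subsetI)
    then have "insert v (cell p) \<subseteq> orbit (Homeo X) v" using orbit_self[OF HX] by (rule insert_subsetI[rotated])
    then show "X \<subseteq> orbit (Homeo X) v" by (simp add: X_eq[symmetric])
  qed
  have "orbits (Homeo X) X = {X}"
  proof
    show "orbits (Homeo X) X \<subseteq> {X}"
      using orbit_eq[OF HX _ vX] transitive by (auto simp: orbits_def)
    show "{X} \<subseteq> orbits (Homeo X) X" using vX transitive by (auto simp: orbits_def)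
  qed
  moreover have "locally_closed_in X X" by (rule locally_closed_in_open) simp
  ultimately have "height (Homeo X) X = enat (card {X} - 1)"
    using height_eq_card_orbits[OF HX closed_X] vX by auto
  then show "height (Homeo X) X = 0" by (simp add: zero_enat_def)
  define H where "H = {f \<in> Homeo X. f v = v}"
  have H: "homeo_subgroup X H"
  proof (rule homeo_subgroup_sub[OF HX])
    show "g \<in> H" if "f \<in> H" "g \<in> Homeo X" "homeomorphism X X f g" for f g
      using that homeomorphism_apply1[OF that(3) vX] by (simp add: H_def)
  qed (auto simp: H_def Homeo_id Homeo_comp)
  interpret cell_group X "{v}" "{p}" H
  proof
    show "cell_map \<gamma> \<in> H" if "\<And>q. q \<in> {p} \<Longrightarrow> order_aut (\<gamma> q)" for \<gamma>
      using cell_map_Homeo[OF that] by (simp add: H_def cell_map_outside)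
  qed (use H in \<open>auto simp: H_def\<close>)
  have "orbits H X = {{v}, cell p}"
  proof -
    have ov: "orbit H v = {v}" using orbit_self[OF H, of v] by (auto simp: orbit_def H_def)
    have op: "orbit H x = cell p" if x: "x \<in> cell p" for x
    proof -
      have xX: "x \<in> X" using x X_eq by simp
      have A: "orbit H x \<in> orbits H X" using xX by (simp add: orbits_def)
      obtain s where s: "x = pt p s" using x unfolding range_pt[symmetric] by (rule rangeE)
      then have "pt p s \<in> orbit H x" using orbit_self[OF H] by simp
      then have "cell p \<subseteq> orbit H x" "orbit H x \<inter> {v} = {}"
        using cell_in_orbit[OF _ A] orbit_disjoint_V[OF _ A] by auto
      then show ?thesis using orbit_subset[OF H xX] X_eq by blast
    qed
    have "orbits H X = insert (orbit H v) (orbit H ` cell p)"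
      unfolding orbits_def image_insert[symmetric] X_eq[symmetric] ..
    also have "orbit H ` cell p = {cell p}" using op cell_nonempty[of p] by auto
    finally show ?thesis using ov by simp
  qed
  moreover have "{v} \<noteq> cell p" using cell_V[of p] by auto
  ultimately have "card (orbits H X) = 2" by simp
  then have "height H X = enat 1" using height_eq_H vX by auto
  moreover obtain G where "homeo_subgroup X G" "height G X = height H X + enat k"
    using exists_subgroup_height_add[of k] vX by auto
  ultimately show "\<exists>G. homeo_subgroup X G \<and> height G X = enat (Suc k)"
    by (intro exI[of _ G]) simp
qed

lemma infinite_cell_structure:
  assumes "cell_structure X V C" "X \<noteq> {}" shows "infinite X"
proof -
  interpret cell_structure X V C by (rule assms(1))
  obtain p where p: "p \<in> C" using assms(2) X_eq by auto
  have "inj (pt p)" using p by (auto simp: inj_def pt_eq_iff)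
  then have "infinite (range (pt p))" using infinite_UNIV_char_0 finite_imageD by blast
  then show ?thesis using cell_subset[OF p] finite_subset unfolding range_pt by blast
qed

lemma heights_of_subgroups:
  assumes X: "cell_structure X V C" "X \<noteq> {}" "connected X"
  shows "\<exists>n. height (Homeo X) X = enat n \<and>
    (\<forall>k. \<exists>G. homeo_subgroup X G \<and> height G X = enat (n + k))"
proof -
  define m where "m = (LEAST m. \<exists>V C. cell_structure X V C \<and> card V = m)"
  have "\<exists>V C. cell_structure X V C \<and> card V = m"
    unfolding m_def using X(1) by (intro LeastI_ex[of "\<lambda>m. \<exists>V C. cell_structure X V C \<and> card V = m"]) blast
  then obtain V C where VC: "cell_structure X V C" "card V = m" by blast
  interpret cell_structure X V C by (rule VC(1))
  note HX = homeo_subgroup_Homeo[of X]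
  show ?thesis
  proof (cases "\<exists>f\<in>Homeo X. \<exists>v\<in>V. f v \<notin> V")
    case True
    then obtain f v where fv: "f \<in> Homeo X" "v \<in> V" "f v \<notin> V" by blast
    have "card (V - {v}) < m" using VC(2) fv(2) finite_V by (metis card_Diff1_less)
    \<comment> \<open>Erasing \<open>v\<close> would beat the minimum, so of the two outcomes for a
      movable vertex only the circle is left.\<close>
    then have "\<nexists>C'. cell_structure X (V - {v}) C'"
      using not_less_Least unfolding m_def by blast
    then obtain p where p: "cell_structure X {v} {p}" using remove_vertex[OF X(3) fv] by blast
    have "f v \<noteq> v" using fv by auto
    note loop = loop_heights[OF p fv(1) this]
    have "\<exists>G. homeo_subgroup X G \<and> height G X = enat k" for k
    \<comment> \<open>Height \<open>0\<close> is that of the full group; the subgroups built from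
      the stabilizer begin at height \<open>1\<close>.\<close>
    proof (cases k)
      case 0
      then show ?thesis using HX loop(1) by (auto simp: zero_enat_def)
    next
      case (Suc j)
      then show ?thesis using loop(2)[of j] by simp
    qed
    then show ?thesis using loop(1) by (intro exI[of _ 0]) (simp add: zero_enat_def)
  next
    case False
    interpret cell_group X V C "Homeo X"
      using HX cell_map_Homeo False by unfold_locales auto
    have C: "C \<noteq> {}" using X(2) X_eq by auto
    show ?thesis
      using height_eq_H[OF X(2)] exists_subgroup_height_add[OF X(2) C]
      by (intro exI[of _ "card (orbits (Homeo X) X) - 1"]) simp
  qed
qed

theorem theorem5p9:
  fixes X :: "'a::metric_space set"
  assumes "topological_graph X"
  shows "height (Homeo X) X < \<infinity> \<and>
         P_h X = {height (Homeo X) X + enat k | k. True} \<union> {\<infinity>}"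
proof -
  obtain V C where VC: "cell_structure X V C" "C \<noteq> {}"
    using assms by (rule topological_graph_cell_structure)
  interpret cell_structure X V C by (rule VC(1))
  have X: "X \<noteq> {}" using VC(2) pt_in by blast
  have "connected X" using assms by (simp add: topological_graph_def)
  then obtain n where n: "height (Homeo X) X = enat n"
    and all: "\<forall>k. \<exists>G. homeo_subgroup X G \<and> height G X = enat (n + k)"
    using heights_of_subgroups[OF VC(1) X] by blast
  have "P_h X \<subseteq> {enat n + enat k | k. True} \<union> {\<infinity>}"
  proof
    fix h assume "h \<in> P_h X"
    then obtain G where G: "homeo_subgroup X G" "h = height G X" by (auto simp: P_h_def)
    then have "G \<subseteq> Homeo X" by (simp add: homeo_subgroup_def)
    \<comment> \<open>What is invariant under the full group is invariant under \<open>G\<close>, so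
      \<open>n\<close> bounds \<open>h\<close> from below and a finite \<open>h\<close> exceeds it
      by a natural number.\<close>
    then have "enat n \<le> h" using height_mono[of G "Homeo X" X] n G(2) by simp
    then show "h \<in> {enat n + enat k | k. True} \<union> {\<infinity>}"
    proof (cases h)
      case (enat j)
      then have "j = n + (j - n)" using \<open>enat n \<le> h\<close> by simp
      then have "h = enat n + enat (j - n)" using enat by simp
      then show ?thesis by blast
    qed simp
  qed
  moreover have "enat n + enat k \<in> P_h X" for k
    using all unfolding P_h_def by (simp, metis)
  moreover have "\<infinity> \<in> P_h X"
  proof -
    have "homeo_subgroup X {id}"
      using Homeo_id[of X] by (auto simp: homeo_subgroup_def intro!: homeomorphismI)
    moreover have "height {id} X = \<infinity>"
      by (rule height_trivial_group[OF infinite_cell_structure[OF VC(1) X]])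
    ultimately show ?thesis by (force simp: P_h_def)
  qed
  ultimately have "P_h X = {enat n + enat k | k. True} \<union> {\<infinity>}" by blast
  then show ?thesis by (simp add: n)
qed

end
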